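(* Given a temporal cost graph $(G,F)$ with $n$ vertices and lifetime $T$, and a natural number $k$ indicating the target number of vertices to visit, \textsc{Changing Cost Temporal Orienteering} on any instance $((G,F),v_s,v_t,k,f)$ is solvable in time $k^{O(k)}T^4n^4\log n$.
   Context: A temporal cost graph is a pair $(G,F)$ where $G=(V,E)$ is a static graph and $F:V\times V\times[T]\times[T]\to\mathbb{N}_0\cup\{\infty\}$ ($F(v_1,v_2,t_1,t_2)$ is the cost of departing $v_1$ at time $t_1$ and arriving at $v_2$ at time $t_2$), with $F(v_1,v_2,t_1,t_2)=\infty$ whenever $t_1\ge t_2$, $F(v,v,t_1,t_2)=0$ for all $v$ and $t_1<t_2$, and $F(v_1,v_2,t_1,t_2)>0$ whenever $v_1\ne v_2$; values of $F$ can be looked up in constant time. The lifetime $T$ is the latest time $t'$ such that $F(v,u,t,t')<\infty$ for some $v,u,t$. A valid walk is a sequence $(u_1,v_1,t_1,t_1'),\dots,(u_\ell,v_\ell,t_\ell,t_\ell')$ with $v_i=u_{i+1}$ and $t_i'\le t_{i+1}$ for consecutive entries, and $t_i<t_i'$, $F(u_i,v_i,t_i,t_i')<\infty$ for all $i$; its cost is $\sum_iF(u_i,v_i,t_i,t_i')$. \textsc{Changing Cost Temporal Orienteering}, on instance $((G,F),v_s,v_t,k,f)$: decide whether there is a valid walk from source $v_s$ to sink $v_t$ visiting at least $k$ distinct vertices (source and sink counted) with cost at most the budget $f$. *)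

theory Defs
  imports Complex_Main "HOL-Library.Extended_Nat"
begin

section \<open>Changing Cost Temporal Orienteering\<close>

text \<open>
  The time domain \<open>[T]\<close> is \<open>{1..T}\<close>.  The function \<open>F\<close> is left unspecified outside
  \<open>V \<times> V \<times> [T] \<times> [T]\<close>; hence \<open>T\<close> is the latest arrival time of finite cost as soon
  as it is one (assumption \<open>lifetime\<close>).  Edges are pairs, so undirected graphs are the
  symmetric case.
\<close>

locale temporal_cost_graph =
  fixes V :: "'v set" and E :: "('v \<times> 'v) set" and T :: nat
    and F :: "'v \<Rightarrow> 'v \<Rightarrow> nat \<Rightarrow> nat \<Rightarrow> enat"
  assumes finite_V: "finite V"
    and edges: "E \<subseteq> V \<times> V"
    and no_time_travel: "\<lbrakk>u \<in> V; v \<in> V; t \<in> {1..T}; t' \<in> {1..T}; t \<ge> t'\<rbrakk> \<Longrightarrow> F u v t t' = \<infinity>"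
    and waiting_free: "\<lbrakk>v \<in> V; t \<in> {1..T}; t' \<in> {1..T}; t < t'\<rbrakk> \<Longrightarrow> F v v t t' = 0"
    and moving_positive: "\<lbrakk>u \<in> V; v \<in> V; t \<in> {1..T}; t' \<in> {1..T}; u \<noteq> v\<rbrakk> \<Longrightarrow> F u v t t' > 0"
    and lifetime: "\<exists>u\<in>V. \<exists>v\<in>V. \<exists>t\<in>{1..T}. F u v t T < \<infinity>"

text \<open>An entry \<open>(u, v, t, t')\<close> departs from \<open>u\<close> at time \<open>t\<close> and arrives at \<open>v\<close> at time \<open>t'\<close>.\<close>

type_synonym 'v walk = "('v \<times> 'v \<times> nat \<times> nat) list"

definition valid_walk ::
  "'v set \<Rightarrow> nat \<Rightarrow> ('v \<Rightarrow> 'v \<Rightarrow> nat \<Rightarrow> nat \<Rightarrow> enat) \<Rightarrow> 'v walk \<Rightarrow> bool" where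
  "valid_walk V T F w \<longleftrightarrow>
     w \<noteq> [] \<and>
     (\<forall>(u, v, t, t') \<in> set w.
        u \<in> V \<and> v \<in> V \<and> t \<in> {1..T} \<and> t' \<in> {1..T} \<and> t < t' \<and> F u v t t' < \<infinity>) \<and>
     successively (\<lambda>(_, v, _, t') (u, _, t, _). v = u \<and> t' \<le> t) w"

definition walk_source :: "'v walk \<Rightarrow> 'v" where
  "walk_source w = (case hd w of (u, v, t, t') \<Rightarrow> u)"

definition walk_sink :: "'v walk \<Rightarrow> 'v" where
  "walk_sink w = (case last w of (u, v, t, t') \<Rightarrow> v)"

definition walk_vertices :: "'v walk \<Rightarrow> 'v set" where
  "walk_vertices w = (\<Union>(u, v, t, t') \<in> set w. {u, v})"

definition walk_cost :: "('v \<Rightarrow> 'v \<Rightarrow> nat \<Rightarrow> nat \<Rightarrow> enat) \<Rightarrow> 'v walk \<Rightarrow> enat" where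
  "walk_cost F w = (\<Sum>(u, v, t, t') \<leftarrow> w. F u v t t')"

definition temporal_orienteering ::
  "'v set \<Rightarrow> nat \<Rightarrow> ('v \<Rightarrow> 'v \<Rightarrow> nat \<Rightarrow> nat \<Rightarrow> enat) \<Rightarrow> 'v \<Rightarrow> 'v \<Rightarrow> nat \<Rightarrow> nat \<Rightarrow> bool" where
  "temporal_orienteering V T F vs vt k f \<longleftrightarrow>
     (\<exists>w. valid_walk V T F w \<and> walk_source w = vs \<and> walk_sink w = vt \<and>
          card (walk_vertices w) \<ge> k \<and> walk_cost F w \<le> enat f)"


section \<open>Machine model\<close>

text \<open>
  Running time is measured on a uniform-cost random access machine, programmed in a
  structured language.  A program uses finitely many registers and finitely many unbounded
  arrays, all holding natural numbers.  Its arithmetic consists of addition and truncated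
  subtraction only: unit-cost multiplication of unbounded numbers would make the machine
  unreasonably powerful.  The cost function is accessed by single lookups at unit cost; a
  lookup yields 0 for an infinite cost and \<open>c + 1\<close> for a finite cost \<open>c\<close>.
\<close>

type_synonym name = string
type_synonym cost_oracle = "nat \<Rightarrow> nat \<Rightarrow> nat \<Rightarrow> nat \<Rightarrow> enat"

datatype expr =
    Const nat
  | Reg name
  | Read name expr
  | Plus expr expr
  | Minus expr expr
  | Lookup expr expr expr expr

datatype prog =
    Skip
  | Assign name expr
  | Write name expr expr
  | Seq prog prog
  | Cond expr prog prog
  | Loop expr prog

type_synonym state = "(name \<Rightarrow> nat) \<times> (name \<Rightarrow> nat \<Rightarrow> nat)"

fun expr_val :: "cost_oracle \<Rightarrow> state \<Rightarrow> expr \<Rightarrow> nat" where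
  "expr_val F s (Const c) = c"
| "expr_val F s (Reg x) = fst s x"
| "expr_val F s (Read a e) = snd s a (expr_val F s e)"
| "expr_val F s (Plus e1 e2) = expr_val F s e1 + expr_val F s e2"
| "expr_val F s (Minus e1 e2) = expr_val F s e1 - expr_val F s e2"
| "expr_val F s (Lookup e1 e2 e3 e4) =
     (case F (expr_val F s e1) (expr_val F s e2) (expr_val F s e3) (expr_val F s e4) of
        enat c \<Rightarrow> Suc c | \<infinity> \<Rightarrow> 0)"

fun expr_time :: "expr \<Rightarrow> nat" where
  "expr_time (Const c) = 1"
| "expr_time (Reg x) = 1"
| "expr_time (Read a e) = 1 + expr_time e"
| "expr_time (Plus e1 e2) = 1 + expr_time e1 + expr_time e2"
| "expr_time (Minus e1 e2) = 1 + expr_time e1 + expr_time e2"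
| "expr_time (Lookup e1 e2 e3 e4) =
     1 + expr_time e1 + expr_time e2 + expr_time e3 + expr_time e4"

text \<open>
  \<open>exec F p s m s'\<close>: with cost function \<open>F\<close>, program \<open>p\<close> started in state \<open>s\<close> terminates
  after \<open>m\<close> steps in state \<open>s'\<close>.  Tests succeed on nonzero values.
\<close>

inductive exec :: "cost_oracle \<Rightarrow> prog \<Rightarrow> state \<Rightarrow> nat \<Rightarrow> state \<Rightarrow> bool" for F where
  Skip: "exec F Skip s 1 s"
| Assign: "exec F (Assign x e) s (1 + expr_time e) ((fst s)(x := expr_val F s e), snd s)"
| Write: "exec F (Write a i e) s (1 + expr_time i + expr_time e)
            (fst s, (snd s)(a := (snd s a)(expr_val F s i := expr_val F s e)))"
| Seq: "\<lbrakk>exec F p s m s'; exec F q s' m' s''\<rbrakk> \<Longrightarrow> exec F (Seq p q) s (m + m') s''"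
| CondTrue: "\<lbrakk>expr_val F s e \<noteq> 0; exec F p s m s'\<rbrakk>
     \<Longrightarrow> exec F (Cond e p q) s (1 + expr_time e + m) s'"
| CondFalse: "\<lbrakk>expr_val F s e = 0; exec F q s m s'\<rbrakk>
     \<Longrightarrow> exec F (Cond e p q) s (1 + expr_time e + m) s'"
| LoopFalse: "expr_val F s e = 0 \<Longrightarrow> exec F (Loop e p) s (1 + expr_time e) s"
| LoopTrue: "\<lbrakk>expr_val F s e \<noteq> 0; exec F p s m s'; exec F (Loop e p) s' m' s''\<rbrakk>
     \<Longrightarrow> exec F (Loop e p) s (1 + expr_time e + m + m') s''"

inductive_cases SkipE: "exec F Skip s m s'"
inductive_cases AssignE: "exec F (Assign x e) s m s'"
inductive_cases WriteE: "exec F (Write a i e) s m s'"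
inductive_cases SeqE: "exec F (Seq p q) s m s'"
inductive_cases CondE: "exec F (Cond e p q) s m s'"
inductive_cases LoopE: "exec F (Loop e p) s m s'"

lemma exec_deterministic:
  "\<lbrakk>exec F p s m s'; exec F p s m' s''\<rbrakk> \<Longrightarrow> m = m' \<and> s' = s''"
proof (induction arbitrary: m' s'' rule: exec.induct)
  case (Skip s)
  then show ?case by (rule SkipE) simp
next
  case (Assign x e s)
  then show ?case by (rule AssignE) simp
next
  case (Write a i e s)
  then show ?case by (rule WriteE) simp
next
  case (Seq p s m1 s1 q m2 s2)
  from Seq.prems obtain n1 r n2 where "m' = n1 + n2" "exec F p s n1 r" "exec F q r n2 s''"
    by (rule SeqE)
  then show ?case using Seq.IH(1)[of n1 r] Seq.IH(2)[of n2 s''] by simp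
next
  case (CondTrue s e p m s' q)
  from CondTrue.prems show ?case
  proof (rule CondE)
    fix n
    assume "m' = Suc (expr_time e + n)" "exec F p s n s''"
    then show ?thesis using CondTrue.IH[of n s''] by simp
  qed (use CondTrue.hyps in simp)
next
  case (CondFalse s e q m s' p)
  from CondFalse.prems show ?case
  proof (rule CondE)
    fix n
    assume "m' = Suc (expr_time e + n)" "exec F q s n s''"
    then show ?thesis using CondFalse.IH[of n s''] by simp
  qed (use CondFalse.hyps in simp)
next
  case (LoopFalse s e p)
  from LoopFalse.prems show ?case by (rule LoopE) (use LoopFalse.hyps in simp_all)
next
  case (LoopTrue s e p m1 s1 m2 s2)
  from LoopTrue.prems show ?case
  proof (rule LoopE)
    fix n1 r n2
    assume "m' = Suc (expr_time e + n1 + n2)" "exec F p s n1 r" "exec F (Loop e p) r n2 s''"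
    then show ?thesis using LoopTrue.IH(1)[of n1 r] LoopTrue.IH(2)[of n2 s''] by simp
  qed (use LoopTrue.hyps in simp)
qed

text \<open>
  An instance over the vertex set \<open>{..<n}\<close> is handed to the machine through six registers and
  the lookups of \<open>F\<close>; the static edges, which walks never refer to, are not supplied.
\<close>

definition input_state :: "nat \<Rightarrow> nat \<Rightarrow> nat \<Rightarrow> nat \<Rightarrow> nat \<Rightarrow> nat \<Rightarrow> state" where
  "input_state n T vs vt k f =
     ((\<lambda>_. 0)(''n'' := n, ''T'' := T, ''source'' := vs, ''sink'' := vt, ''k'' := k, ''budget'' := f),
      (\<lambda>_ _. 0))"

definition accepting :: "state \<Rightarrow> bool" where
  "accepting s \<longleftrightarrow> fst s ''answer'' \<noteq> 0"

definition solves_temporal_orienteering :: "prog \<Rightarrow> (nat \<Rightarrow> nat \<Rightarrow> nat \<Rightarrow> real) \<Rightarrow> bool" where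
  "solves_temporal_orienteering p bound \<longleftrightarrow>
     (\<forall>n E T F vs vt k f.
        temporal_cost_graph {..<n} E T F \<and> vs < n \<and> vt < n \<longrightarrow>
        (\<exists>m s. exec F p (input_state n T vs vt k f) m s \<and>
               (accepting s \<longleftrightarrow> temporal_orienteering {..<n} T F vs vt k f) \<and>
               real m \<le> bound n T k))"

end

theory Submission
  imports Defs
begin

text \<open>
  Colour vertices by their residue modulo \<open>m\<close>.  Some \<open>m < M = 3 + k\<^sup>2 L\<close> with \<open>n \<le> 2 ^ L\<close> is
  injective on the first \<open>k\<close> vertices of an optimal walk: otherwise the product of their
  differences, which is at most \<open>2 ^ (k\<^sup>2 L)\<close>, would be a multiple of all numbers below \<open>M\<close>, hence at least
  \<open>2 ^ (M - 2)\<close>.  The program tries all \<open>m\<close> together with all sequences of \<open>k\<close> colours.  For each of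
  these \<open>M ^ (k + 1)\<close> guesses, a dynamic program over (vertex, time) pairs finds the cheapest walk
  that visits vertices of the guessed colours in the guessed order: \<open>k\<close> times, discard all
  vertices that do not have the next colour and extend by further moves, in time \<open>O(k T\<^sup>2 n\<^sup>2)\<close>.
  Finally \<open>L ^ (k + 1) \<le> (k + 1) ^ (k + 1) * exp L\<close> bounds the number of guesses by
  \<open>k ^ O(k) * n\<^sup>2\<close>.
\<close>

section \<open>Separating moduli and counting\<close>

text \<open>Only first visits are matched with colours: a walk may revisit vertices and pass through
  vertices of any colour, so between two matches the relaxation is unrestricted. Guessing the
  colours in order, instead of storing the set of collected colours, leaves a single table per
  guess; the order is paid for within \<open>k ^ O(k)\<close>. The budget and the costs may be
  arbitrarily large compared with \<open>n\<close>, \<open>T\<close> and \<open>k\<close>, so a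
  table is not indexed by cost but stores the best remaining budget. Every move of finite cost
  strictly advances time, which is why one sweep settles a table. Errors are one-sided: every guess,
  however bad, may only report genuine walks, whereas completeness is needed for one good guess.
  Residues suit the machine, as a cyclic counter computes them without multiplication or division.
  The final \<open>n ^ 4\<close> is \<open>n ^ 2\<close> for the guesses times \<open>n ^ 2\<close>
  for the relaxation.\<close>

lemma common_multiple_ge_power2:
  fixes D n :: nat
  assumes dvd: "\<And>m. 1 \<le> m \<Longrightarrow> m \<le> Suc n \<Longrightarrow> m dvd D" and "D > 0"
  shows "2 ^ n \<le> D"
proof -
  \<comment> \<open>The entries of Leibniz's harmonic triangle are integer combinations of \<open>1/1, \<dots>, 1/(n+1)\<close>.\<close>
  have ints: "j \<le> i \<Longrightarrow> i \<le> n \<Longrightarrow> real D / (real (Suc i) * real (i choose j)) \<in> \<int>" for i j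
  proof (induction j arbitrary: i)
    case 0
    have "Suc i dvd D" using 0 by (intro dvd) auto
    then obtain q where "D = Suc i * q" ..
    then have "real D / (real (Suc i) * real (i choose 0)) = real q"
      by (simp only: of_nat_mult) (simp del: of_nat_Suc)
    then show ?case by simp
  next
    case (Suc j)
    then obtain i' where i: "i = Suc i'" by (cases i) auto
    \<comment> \<open>\<open>a\<close> is the common value of
      \<open>(j+1) * (i choose (j+1))\<close> and \<open>(i-j) * (i choose j)\<close>. It puts both
      reciprocals over the denominator \<open>(i+1) * a\<close>, where the numerators
      \<open>j+1\<close> and \<open>i-j\<close> add up to \<open>i+1\<close>.\<close>
    define a where "a = real (Suc i') * real (i' choose j)"
    have ji: "j \<le> i'" using Suc.prems i by simp
    then have a: "a > 0" by (simp add: a_def)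
    have 1: "real (i choose Suc j) * real (Suc j) = a"
      using Suc_times_binomial[of j i'] unfolding i a_def of_nat_mult[symmetric] by (simp only: mult.commute)
    have 2: "real (i choose j) * real (i - j) = a"
      using binomial_absorb_comp[of i j] unfolding i a_def of_nat_mult[symmetric] by (simp add: mult.commute)
    have frac: "1 / (x * y) = z / (x * a)" if "y * z = a" for x y z :: real
      using a that by auto
    have "1 / (real (Suc i) * real (i choose Suc j)) = real (Suc j) / (real (Suc i) * a)"
      using 1 by (rule frac)
    moreover have "1 / (real (Suc i) * real (i choose j)) = real (i - j) / (real (Suc i) * a)"
      using 2 by (rule frac)
    moreover have "real (Suc j) / (real (Suc i) * a) + real (i - j) / (real (Suc i) * a) = 1 / a"
    proof -
      have "real (Suc j) + real (i - j) = real (Suc i)" using ji i by simp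
      then have "real (Suc j) / (real (Suc i) * a) + real (i - j) / (real (Suc i) * a)
          = real (Suc i) / (real (Suc i) * a)"
        by (simp only: add_divide_distrib[symmetric])
      then show ?thesis by (simp del: of_nat_Suc)
    qed
    ultimately have eq: "1 / (real (Suc i) * real (i choose Suc j))
        = 1 / (real (Suc i') * real (i' choose j)) - 1 / (real (Suc i) * real (i choose j))"
      by (simp add: a_def)
    have "real D / (real (Suc i) * real (i choose Suc j))
        = real D / (real (Suc i') * real (i' choose j)) - real D / (real (Suc i) * real (i choose j))"
      using arg_cong[OF eq, of "\<lambda>x. real D * x"] by (simp add: right_diff_distrib)
    moreover have "real D / (real (Suc i') * real (i' choose j)) \<in> \<int>"
      using Suc.IH[of i'] Suc.prems ji i by simp
    moreover have "real D / (real (Suc i) * real (i choose j)) \<in> \<int>"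
      using Suc.IH[of i] Suc.prems by simp
    ultimately show ?case by simp
  qed
  \<comment> \<open>The largest entry of row \<open>n\<close> is at least the average
    \<open>2 ^ n / (n+1)\<close>; a positive integer quotient \<open>D / ((n+1) * b)\<close>
    therefore yields \<open>D >= (n+1) * b >= 2 ^ n\<close>.\<close>
  define b where "b = n choose (n div 2)"
  have "real D / (real (Suc n) * real b) \<in> \<int>"
    unfolding b_def by (rule ints) auto
  moreover have b: "b > 0" by (simp add: b_def)
  ultimately have "1 \<le> real D / (real (Suc n) * real b)"
    using \<open>D > 0\<close> by (metis Ints_cases divide_pos_pos of_int_0_less_iff of_int_1_le_iff of_nat_0_less_iff
      int_one_le_iff_zero_less zero_less_Suc mult_pos_pos)
  moreover have "0 < real (Suc n) * real b" using b by simp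
  ultimately have "real (Suc n) * real b \<le> real D" by (simp only: le_divide_eq_1_pos)
  then have le: "Suc n * b \<le> D" by (simp only: of_nat_mult[symmetric] of_nat_le_iff)
  have "(2::nat) ^ n = (\<Sum>i\<le>n. n choose i)" by (rule choose_row_sum[symmetric])
  also have "\<dots> \<le> (\<Sum>i\<le>n. b)" unfolding b_def by (intro sum_mono binomial_maximum)
  also have "\<dots> = Suc n * b" by simp
  finally show ?thesis using le by linarith
qed

lemma separating_modulus:
  fixes S :: "nat set"
  assumes S: "S \<subseteq> {..<n}" and card: "card S \<le> k" and n: "n \<le> 2 ^ L"
  shows "\<exists>m. 0 < m \<and> m < 3 + k * k * L \<and> inj_on (\<lambda>x. x mod m) S"
proof (rule ccontr)
  assume no: "\<not> ?thesis"
  have fin: "finite S" using S finite_subset by blast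
  define P where "P = {(x, y) \<in> S \<times> S. x < y}"
  have finP: "finite P" unfolding P_def using fin by (rule_tac finite_subset[of _ "S \<times> S"]) auto
  define D where "D = (\<Prod>(x, y)\<in>P. y - x)"
  have "D > 0" unfolding D_def by (rule prod_pos) (auto simp: P_def)
  \<comment> \<open>The offset 3 in the range of moduli comes from here: with all of
    \<open>1, ..., 2 + k * k * L\<close> dividing \<open>D\<close>, the lower bound has one factor 2
    more than the upper bound \<open>2 ^ (k * k * L)\<close>.\<close>
  have "2 ^ (1 + k * k * L) \<le> D"
  proof (rule common_multiple_ge_power2)
    fix m :: nat assume m: "1 \<le> m" "m \<le> Suc (1 + k * k * L)"
    then have "0 < m" "m < 3 + k * k * L" by auto
    then have "\<not> inj_on (\<lambda>x. x mod m) S" using no by blast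
    then obtain x y where xy: "x \<in> S" "y \<in> S" "x < y" "x mod m = y mod m"
      unfolding inj_on_def by (metis nat_neq_iff)
    then have "m dvd y - x" using mod_eq_dvd_iff_nat[of x y m] by auto
    moreover have "y - x dvd D"
      unfolding D_def using dvd_prodI[OF finP, of "(x, y)" "\<lambda>(x, y). y - x"] xy by (auto simp: P_def)
    ultimately show "m dvd D" by (rule dvd_trans)
  qed fact
  moreover have "D \<le> (\<Prod>p\<in>P. 2 ^ L)"
    unfolding D_def using S n by (intro prod_mono) (force simp: P_def)
  moreover have "card P \<le> k * k"
  proof -
    have "card P \<le> card (S \<times> S)" using fin by (intro card_mono) (auto simp: P_def)
    also have "\<dots> \<le> k * k" using card by (simp add: card_cartesian_product mult_le_mono)
    finally show ?thesis .
  qed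
  then have "(\<Prod>p\<in>P. 2 ^ L) \<le> (2::nat) ^ (k * k * L)"
    by (simp add: power_mult[symmetric] mult.commute)
  ultimately have "2 ^ (1 + k * k * L) \<le> (2::nat) ^ (k * k * L)" by linarith
  then show False by simp
qed

text \<open>Guarantees that the good guess occurs among the counter values of the main loop. Digits
  are least significant first, so the induction shifts \<open>d\<close> and puts \<open>d 0\<close>
  into the units place.\<close>

lemma exists_digits:
  fixes M :: nat
  assumes "\<And>i. i < j \<Longrightarrow> d i < M"
  shows "\<exists>N < M ^ j. \<forall>i<j. N div M ^ i mod M = d i"
  using assms
proof (induction j arbitrary: d)
  case (Suc j)
  from Suc.IH[of "\<lambda>i. d (Suc i)"] Suc.prems
  obtain N where N: "N < M ^ j" "\<And>i. i < j \<Longrightarrow> N div M ^ i mod M = d (Suc i)" by auto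
  have d0: "d 0 < M" using Suc.prems by simp
  show ?case
  proof (intro exI conjI allI impI)
    have "d 0 + M * N < M * Suc N" using d0 by simp
    also have "\<dots> \<le> M * M ^ j" using N by (intro mult_le_mono) auto
    finally show "d 0 + M * N < M ^ Suc j" by simp
    show "(d 0 + M * N) div M ^ i mod M = d i" if "i < Suc j" for i
    proof (cases i)
      case (Suc i')
      have "(d 0 + M * N) div M = N" using d0 by simp
      then show ?thesis using N(2)[of i'] that Suc by (simp add: div_mult2_eq)
    qed (use d0 in simp)
  qed
qed simp

text \<open>Follows from \<open>(1 + x / N) ^ N <= exp x\<close> with \<open>N = k + 1\<close>.
  Applied to \<open>x = L + 1\<close>, it trades a power of the logarithm for a function of
  \<open>k\<close> times a polynomial in \<open>n\<close>.\<close>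

lemma power_le_power_times_exp:
  "real x ^ Suc k \<le> real (Suc k) ^ Suc k * exp (real x)"
proof -
  have "(real x / real (Suc k)) ^ Suc k \<le> (1 + real x / real (Suc k)) ^ Suc k"
    by (intro power_mono) auto
  also have "\<dots> \<le> exp (real x)" by (rule exp_ge_one_plus_x_over_n_power_n) auto
  finally show ?thesis by (simp add: power_divide field_simps del: of_nat_Suc power_Suc)
qed

text \<open>The exponent \<open>3 * Suc k\<close> is \<open>2 * Suc k\<close> from the factor
  \<open>k * k\<close> plus \<open>Suc k\<close> from the preceding lemma. The constant is
  \<open>36 = 3 * 12\<close>, with \<open>exp (L+1) <= 3 ^ (L+1) <= 3 * 4 ^ L <= 3 * (2 * n) ^ 2 =
  12 * n ^ 2\<close>.\<close>

lemma polylog_power_bound: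
  assumes "2 ^ L \<le> 2 * n"
  shows "(3 + k * k * L) ^ Suc k \<le> 36 * 3 ^ k * Suc k ^ (3 * Suc k) * n\<^sup>2"
proof -
  have "3 + k * k * L \<le> 3 * (Suc k * Suc k * Suc L)" by (simp add: algebra_simps)
  then have "(3 + k * k * L) ^ Suc k \<le> (3 * (Suc k * Suc k * Suc L)) ^ Suc k"
    by (rule power_mono) simp
  also have "\<dots> = 3 * 3 ^ k * Suc k ^ (2 * Suc k) * Suc L ^ Suc k"
  proof -
    have "(3 * (a * a * l)) ^ Suc j = 3 * 3 ^ j * a ^ (2 * Suc j) * l ^ Suc j" for a l j :: nat
      by (simp add: power_mult_distrib mult_2 power_add)
    then show ?thesis .
  qed
  also have "Suc L ^ Suc k \<le> Suc k ^ Suc k * (12 * n\<^sup>2)"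
  proof -
    have "real (Suc L) ^ Suc k \<le> real (Suc k) ^ Suc k * exp (real (Suc L))"
      by (rule power_le_power_times_exp)
    also have "exp (real (Suc L)) = exp 1 ^ Suc L"
      by (metis exp_of_nat_mult mult.right_neutral)
    also have "exp 1 ^ Suc L \<le> (3::real) ^ Suc L" by (intro power_mono exp_le) simp
    also have "(3::real) ^ Suc L \<le> 3 * (2 ^ L) ^ 2"
      by (simp add: power_mult[symmetric] mult.commute[of _ 2]) (simp add: power_mult power_mono)
    also have "real (Suc k) ^ Suc k * (3 * (2 ^ L)\<^sup>2) \<le> real (Suc k) ^ Suc k * (3 * (2 * real n) ^ 2)"
    proof -
      have "(2::real) ^ L \<le> 2 * real n"
        using assms by (metis of_nat_le_iff of_nat_mult of_nat_numeral of_nat_power)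
      then show ?thesis by (intro mult_left_mono power_mono) auto
    qed
    finally have "real (Suc L ^ Suc k) \<le> real (Suc k ^ Suc k * (12 * n\<^sup>2))"
      by (simp add: power_mult_distrib del: power_Suc of_nat_Suc)
    then show ?thesis by (simp only: of_nat_le_iff)
  qed
  also have "3 * 3 ^ k * Suc k ^ (2 * Suc k) * (Suc k ^ Suc k * (12 * n\<^sup>2))
      = 36 * 3 ^ k * Suc k ^ (3 * Suc k) * n\<^sup>2"
  proof -
    have "3 * Suc k = 2 * Suc k + Suc k" by simp
    then show ?thesis by (simp only: power_add)
  qed
  finally show ?thesis by simp
qed

text \<open>Turns powers of \<open>k + 1\<close> into powers of \<open>k\<close>. For
  \<open>k >= 2\<close>, both 3 and \<open>k + 1\<close> are at most \<open>k ^ 2\<close>; the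
  constant factor is the value of the left side at \<open>k = 1\<close>, where powers of
  \<open>k\<close> are of no help.\<close>

lemma power_Suc_le_power_self:
  "3 ^ k * Suc k ^ (3 * Suc k + a) \<le> 3 * 2 ^ (6 + a) * k ^ ((14 + 2 * a) * k)"
proof -
  consider "k = 0" | "k = 1" | "k \<ge> 2" by linarith
  then show ?thesis
  proof cases
    case 2
    then have "Suc k = 2" by simp
    then show ?thesis using 2 by (simp only: \<open>Suc k = 2\<close>) (simp add: power_add)
  next
    case 3
    have sq: "2 * k \<le> k ^ 2" using 3 by (simp add: power2_eq_square)
    have "3 ^ k * Suc k ^ (3 * Suc k + a) \<le> (k ^ 2) ^ k * (k ^ 2) ^ (3 * Suc k + a)"
      using sq 3 by (intro mult_le_mono power_mono) auto
    also have "\<dots> = k ^ (2 * k + 2 * (3 * Suc k + a))" by (simp only: power_mult power_add)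
    also have "\<dots> \<le> k ^ ((14 + 2 * a) * k)"
    proof (rule power_increasing)
      have "2 * a * 1 \<le> 2 * a * k" using 3 by (intro mult_le_mono) auto
      then show "2 * k + 2 * (3 * Suc k + a) \<le> (14 + 2 * a) * k" using 3 by (simp add: algebra_simps)
    qed (use 3 in auto)
    also have "\<dots> \<le> 3 * 2 ^ (6 + a) * k ^ ((14 + 2 * a) * k)" by simp
    finally show ?thesis .
  qed simp
qed

section \<open>Relaxation in time order\<close>

text \<open>
  Cell \<open>t * n + v\<close> of the table belongs to vertex \<open>v\<close> at time \<open>Suc t\<close>.  It holds the largest
  remaining budget plus one, so that 0 stands for "unreachable within the budget" and
  truncated subtraction turns every exceeded budget into this value.
\<close>

definition relax1 ::
  "cost_oracle \<Rightarrow> nat \<Rightarrow> nat \<Rightarrow> nat \<Rightarrow> nat \<Rightarrow> nat \<Rightarrow> (nat \<Rightarrow> nat) \<Rightarrow> nat \<Rightarrow> nat" where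
  "relax1 F n t' t u v R = (case F u v (Suc t) (Suc t') of
     enat c \<Rightarrow> R(t' * n + v := max (R (t' * n + v)) (R (t * n + u) - c)) | \<infinity> \<Rightarrow> R)"

definition relax_row ::
  "cost_oracle \<Rightarrow> nat \<Rightarrow> nat \<Rightarrow> nat \<Rightarrow> (nat \<Rightarrow> nat) \<Rightarrow> nat \<Rightarrow> nat" where
  "relax_row F n T t' =
     fold (\<lambda>t. fold (\<lambda>u. fold (\<lambda>v. relax1 F n t' t u v) [0..<n]) [0..<n]) [0..<T]"

text \<open>Rows are processed by increasing arrival time, so row \<open>t'\<close> reads only
  settled rows: departures at or after the arrival are also tried by \<open>relax_row\<close>, but
  their cost is infinite.\<close>

definition relax :: "cost_oracle \<Rightarrow> nat \<Rightarrow> nat \<Rightarrow> (nat \<Rightarrow> nat) \<Rightarrow> nat \<Rightarrow> nat" where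
  "relax F n T = fold (relax_row F n T) [0..<T]"

lemma fold_invariant_on:
  assumes "\<And>x B. x \<in> set xs \<Longrightarrow> P B \<Longrightarrow> P (f x B)" and "P A"
  shows "P (fold f xs A)"
  using assms by (induction xs arbitrary: A) auto

text \<open>Describes an event in the middle of a fold: \<open>Q\<close> survives until
  \<open>x\<close> is processed, \<open>x\<close> turns \<open>Q\<close> into \<open>P\<close>, and
  \<open>P\<close> survives the rest.\<close>

lemma fold_hit:
  assumes "x \<in> set xs" and "Q A"
    and "\<And>y B. y \<in> set xs \<Longrightarrow> Q B \<Longrightarrow> Q (f y B)"
    and "\<And>B. Q B \<Longrightarrow> P (f x B)"
    and "\<And>y B. y \<in> set xs \<Longrightarrow> Q B \<Longrightarrow> P B \<Longrightarrow> P (f y B)"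
  shows "P (fold f xs A)"
proof -
  obtain ys zs where xs: "xs = ys @ x # zs" using assms(1) split_list by metis
  have "Q (fold f ys A)" by (rule fold_invariant_on) (use assms xs in auto)
  then have "P (f x (fold f ys A)) \<and> Q (f x (fold f ys A))" using assms xs by auto
  then have "P (fold f zs (f x (fold f ys A))) \<and> Q (fold f zs (f x (fold f ys A)))"
    by (rule fold_invariant_on[rotated]) (use assms xs in auto)
  then show ?thesis using xs by simp
qed

lemma relax1_mono: "R p \<le> relax1 F n t' t u v R p"
  by (auto simp: relax1_def split: enat.split)

lemma relax1_other: "v < n \<Longrightarrow> p div n \<noteq> t' \<Longrightarrow> relax1 F n t' t u v R p = R p"
  by (auto simp: relax1_def split: enat.split)

lemma relax_row_invariant:
  assumes "\<And>t u v R. t < T \<Longrightarrow> u < n \<Longrightarrow> v < n \<Longrightarrow> P R \<Longrightarrow> P (relax1 F n t' t u v R)" and "P R"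
  shows "P (relax_row F n T t' R)"
  unfolding relax_row_def
  by (rule fold_invariant_on[where P = P], rule fold_invariant_on[where P = P],
      rule fold_invariant_on[where P = P]) (use assms in simp_all)

lemma relax_invariant:
  assumes "\<And>t' t u v R. t' < T \<Longrightarrow> t < T \<Longrightarrow> u < n \<Longrightarrow> v < n \<Longrightarrow> P R \<Longrightarrow> P (relax1 F n t' t u v R)"
    and "P R"
  shows "P (relax F n T R)"
  unfolding relax_def
  by (rule fold_invariant_on[where P = P], rule relax_row_invariant[where P = P]) (use assms in simp_all)

lemma relax_mono: "R p \<le> relax F n T R p"
  by (rule relax_invariant[where P = "\<lambda>R'. R p \<le> R' p"]) (simp_all add: order_trans[OF _ relax1_mono])

lemma relax_row_other: "p div n \<noteq> t' \<Longrightarrow> relax_row F n T t' R p = R p"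
  by (rule relax_row_invariant[where P = "\<lambda>R'. R' p = R p"]) (auto simp: relax1_other)

text \<open>Processing row \<open>t'\<close> writes into that row only, so the departure cell keeps
  its value \<open>a\<close> throughout (\<open>Q\<close>). The update for the given move
  establishes the bound on the arrival cell (\<open>P\<close>), and later updates only increase that
  cell.\<close>

lemma relax_row_step:
  assumes "t \<noteq> t'" "t < T" "u < n" "v < n" "F u v (Suc t) (Suc t') = enat c"
  shows "relax_row F n T t' R (t * n + u) - c \<le> relax_row F n T t' R (t' * n + v)"
proof -
  define a where "a = R (t * n + u)"
  define Q where "Q R' \<longleftrightarrow> R' (t * n + u) = a" for R' :: "nat \<Rightarrow> nat"
  define P where "P R' \<longleftrightarrow> a - c \<le> R' (t' * n + v)" for R' :: "nat \<Rightarrow> nat"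
  have Q1: "Q (relax1 F n t' x y z R')" if "Q R'" "z < n" for R' x y z
    using that assms relax1_other[of z n "t * n + u" t'] by (simp add: Q_def)
  have P1: "P (relax1 F n t' x y z R')" if "P R'" for R' x y z
    using that relax1_mono[of R' "t' * n + v" F n t' x y z] by (simp add: P_def)
  have hit: "P (relax1 F n t' t u v R')" if "Q R'" for R'
    using that assms by (auto simp: P_def Q_def relax1_def)
  have Q2: "Q (fold (relax1 F n t' x y) [0..<n] R')" if "Q R'" for R' x y
    using that by (rule fold_invariant_on[where P = Q, rotated]) (simp add: Q1)
  have Q3: "Q (fold (\<lambda>y. fold (relax1 F n t' x y) [0..<n]) [0..<n] R')" if "Q R'" for R' x
    using that by (rule fold_invariant_on[where P = Q, rotated]) (simp add: Q2)
  have P2: "P (fold (relax1 F n t' x y) [0..<n] R')" if "P R'" for R' x y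
    using that by (rule fold_invariant_on[where P = P, rotated]) (simp add: P1)
  have P3: "P (fold (\<lambda>y. fold (relax1 F n t' x y) [0..<n]) [0..<n] R')" if "P R'" for R' x
    using that by (rule fold_invariant_on[where P = P, rotated]) (simp add: P2)
  have hit2: "P (fold (relax1 F n t' t u) [0..<n] R')" if "Q R'" for R'
    by (rule fold_hit[where x = v and Q = Q]) (use that assms hit Q1 P1 in auto)
  have hit3: "P (fold (\<lambda>y. fold (relax1 F n t' t y) [0..<n]) [0..<n] R')" if "Q R'" for R'
    by (rule fold_hit[where x = u and Q = Q]) (use that assms hit2 Q2 P2 in auto)
  have "P (relax_row F n T t' R)"
    unfolding relax_row_def
    by (rule fold_hit[where x = t and Q = Q]) (use assms hit3 Q3 P3 in \<open>auto simp: Q_def[of R] a_def\<close>)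
  moreover have "relax_row F n T t' R (t * n + u) = a"
    using assms by (simp add: relax_row_other a_def)
  ultimately show ?thesis by (simp add: P_def)
qed

text \<open>The Bellman inequality of the finished table. It holds once row \<open>t'\<close> is
  processed, and afterwards only rows later than both \<open>t\<close> and \<open>t'\<close>
  change.\<close>

lemma relax_step:
  assumes "t < t'" "t' < T" "u < n" "v < n" "F u v (Suc t) (Suc t') = enat c"
  shows "relax F n T R (t * n + u) - c \<le> relax F n T R (t' * n + v)"
proof -
  have "[0..<T] = [0..<t'] @ t' # [Suc t'..<T]"
    using assms upt_add_eq_append[of 0 t' "T - t'"] by (simp add: upt_conv_Cons)
  then have R: "relax F n T R
      = fold (relax_row F n T) [Suc t'..<T] (relax_row F n T t' (fold (relax_row F n T) [0..<t'] R))"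
    by (simp add: relax_def)
  show ?thesis
    unfolding R
  proof (rule fold_invariant_on[where P = "\<lambda>R. R (t * n + u) - c \<le> R (t' * n + v)"])
    show "relax_row F n T t' R' (t * n + u) - c \<le> relax_row F n T t' R' (t' * n + v)" for R'
      by (rule relax_row_step) (use assms in auto)
    fix s R' assume "s \<in> set [Suc t'..<T]" "R' (t * n + u) - c \<le> R' (t' * n + v)"
    then show "relax_row F n T s R' (t * n + u) - c \<le> relax_row F n T s R' (t' * n + v)"
      using assms by (simp add: relax_row_other)
  qed
qed

section \<open>Correctness of the dynamic program\<close>

locale orienteering_instance = temporal_cost_graph "{..<n}" E T F
  for n :: nat and E :: "(nat \<times> nat) set" and T :: nat and F :: cost_oracle +
  fixes vs vt k f :: nat
  assumes source: "vs < n" and sink: "vt < n"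
begin

lemma T_ge_2: "2 \<le> T"
proof (rule ccontr)
  assume "\<not> 2 \<le> T"
  with lifetime no_time_travel show False by fastforce
qed

text \<open>The list records the distinct vertices in the order of their first visit.\<close>

inductive trace :: "nat \<Rightarrow> nat \<Rightarrow> nat list \<Rightarrow> nat \<Rightarrow> bool" where
  start: "trace vs 1 [vs] 0"
| step: "\<lbrakk>trace u t xs c; v < n; t < t'; t' \<le> T; F u v t t' = enat c'\<rbrakk>
    \<Longrightarrow> trace v t' (if v \<in> set xs then xs else xs @ [v]) (c + c')"

lemma trace_props:
  "trace v t xs c \<Longrightarrow> v < n \<and> 1 \<le> t \<and> t \<le> T \<and> distinct xs \<and> v \<in> set xs \<and> set xs \<subseteq> {..<n}"
  by (induction rule: trace.induct) (use source T_ge_2 in auto)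

text \<open>Waiting is a self-move of cost 0 to a recorded vertex, so neither list nor cost changes.
  It bridges the gaps between walk entries and fixes the arrival time of solutions to
  \<open>T\<close>.\<close>

lemma trace_wait:
  assumes "trace v t xs c" "t \<le> t'" "t' \<le> T"
  shows "trace v t' xs c"
proof (cases "t = t'")
  case False
  note p = trace_props[OF assms(1)]
  have "F v v t t' = enat 0" using waiting_free[of v t t'] p assms False by (simp add: zero_enat_def)
  from step[OF assms(1) _ _ _ this] show ?thesis using p assms False by simp
qed (use assms in simp)

text \<open>The first alternative is the initial trace: it has made no move, while valid walks are
  nonempty.\<close>

lemma trace_imp_walk:
  assumes "trace v t xs c"
  shows "t = 1 \<and> v = vs \<and> xs = [vs] \<and> c = 0 \<or>
    (\<exists>w. valid_walk {..<n} T F w \<and> walk_source w = vs \<and> walk_sink w = v \<and>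
         snd (snd (snd (last w))) = t \<and> walk_vertices w = set xs \<and> walk_cost F w = enat c)"
  using assms
proof (induction rule: trace.induct)
  case (step u t xs c v t' c')
  let ?e = "(u, v, t, t')"
  have p: "u < n" "1 \<le> t" "u \<in> set xs" using trace_props[OF step.hyps(1)] by auto
  have set: "set (if v \<in> set xs then xs else xs @ [v]) = insert v (set xs)" by auto
  from step.IH show ?case
  proof (elim disjE exE conjE)
    assume "t = 1" "u = vs" "xs = [vs]" "c = 0"
    then show ?thesis
      using step p source
      by (intro disjI2 exI[of _ "[?e]"])
        (auto simp: valid_walk_def walk_source_def walk_sink_def walk_vertices_def walk_cost_def)
  next
    fix w assume w: "valid_walk {..<n} T F w" "walk_source w = vs" "walk_sink w = u"
      "snd (snd (snd (last w))) = t" "walk_vertices w = set xs" "walk_cost F w = enat c"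
    then have "w \<noteq> []" by (simp add: valid_walk_def)
    moreover obtain a b where "last w = (a, u, b, t)" using w by (cases "last w") (auto simp: walk_sink_def)
    ultimately have "valid_walk {..<n} T F (w @ [?e])"
      using w step p by (auto simp: valid_walk_def successively_append_iff)
    moreover have "walk_vertices (w @ [?e]) = insert v (set xs)"
      using w p by (auto simp: walk_vertices_def)
    moreover have "walk_cost F (w @ [?e]) = enat (c + c')"
      using w step by (simp add: walk_cost_def)
    ultimately show ?thesis
      using w \<open>w \<noteq> []\<close> set
      by (intro disjI2 exI[of _ "w @ [?e]"]) (simp add: walk_source_def walk_sink_def)
  qed
qed simp

lemma walk_imp_trace:
  assumes "valid_walk {..<n} T F w" "walk_source w = vs"
  shows "\<exists>xs c. trace (walk_sink w) (snd (snd (snd (last w)))) xs c \<and>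
    set xs = walk_vertices w \<and> walk_cost F w = enat c"
  using assms
proof (induction w rule: rev_induct)
  case Nil
  then show ?case by (simp add: valid_walk_def)
next
  case (snoc e w)
  obtain u v t t' where e: "e = (u, v, t, t')" by (cases e)
  from snoc.prems have ev: "u < n" "v < n" "1 \<le> t" "t < t'" "t' \<le> T" "F u v t t' < \<infinity>"
    by (auto simp: valid_walk_def e)
  then obtain c' where c': "F u v t t' = enat c'" by auto
  \<comment> \<open>Treats empty and nonempty prefixes alike: in both cases a trace waits at
    \<open>u\<close> until the departure time \<open>t\<close> of the last entry.\<close>
  have "\<exists>xs c. trace u t xs c \<and> insert v (set xs) = walk_vertices (w @ [e]) \<and> walk_cost F w = enat c"
  proof (cases "w = []")
    case True
    then have "u = vs" using snoc.prems by (simp add: walk_source_def e)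
    then have "trace u t [vs] 0" using trace_wait[OF start, of t] ev by simp
    then show ?thesis
      using True \<open>u = vs\<close> by (intro exI[of _ "[vs]"] exI[of _ 0]) (auto simp: walk_vertices_def walk_cost_def e zero_enat_def)
  next
    case False
    then have w: "valid_walk {..<n} T F w" "walk_source w = vs"
      using snoc.prems by (auto simp: valid_walk_def walk_source_def successively_append_iff)
    with snoc.IH obtain xs c where xs: "trace (walk_sink w) (snd (snd (snd (last w)))) xs c"
      "set xs = walk_vertices w" "walk_cost F w = enat c" by blast
    moreover have "walk_sink w = u" "snd (snd (snd (last w))) \<le> t"
      using False snoc.prems by (cases "last w"; auto simp: valid_walk_def successively_append_iff e walk_sink_def)+
    ultimately have "trace u t xs c" using ev trace_wait[of u _ xs c t] by auto
    moreover have "u \<in> set xs" using trace_props calculation by blast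
    ultimately show ?thesis
      using xs by (intro exI[of _ xs] exI[of _ c]) (auto simp: walk_vertices_def e)
  qed
  then obtain xs c where xs: "trace u t xs c" "insert v (set xs) = walk_vertices (w @ [e])"
    "walk_cost F w = enat c" by blast
  let ?ys = "if v \<in> set xs then xs else xs @ [v]"
  have "trace v t' ?ys (c + c')" using xs ev c' by (intro step[of u t xs c]) auto
  moreover have "set ?ys = walk_vertices (w @ [e])" using xs by auto
  moreover have "walk_cost F (w @ [e]) = enat (c + c')" using xs c' by (simp add: walk_cost_def e)
  ultimately show ?case by (auto simp: walk_sink_def e simp del: set_append intro!: exI[of _ ?ys])
qed

text \<open>Since \<open>T >= 2\<close>, a trace at time \<open>T\<close> is not the initial one and
  comes from a nonempty walk. As the list is distinct, its length counts the visited
  vertices.\<close>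

lemma orienteering_iff_trace:
  "temporal_orienteering {..<n} T F vs vt k f \<longleftrightarrow>
     (\<exists>xs c. trace vt T xs c \<and> k \<le> length xs \<and> c \<le> f)"
proof
  assume "temporal_orienteering {..<n} T F vs vt k f"
  then obtain w where w: "valid_walk {..<n} T F w" "walk_source w = vs" "walk_sink w = vt"
    "k \<le> card (walk_vertices w)" "walk_cost F w \<le> enat f"
    by (auto simp: temporal_orienteering_def)
  with walk_imp_trace obtain xs c where xs: "trace vt (snd (snd (snd (last w)))) xs c"
    "set xs = walk_vertices w" "walk_cost F w = enat c" by blast
  have "trace vt T xs c" by (rule trace_wait[OF xs(1)]) (use trace_props[OF xs(1)] in auto)
  moreover have "length xs = card (walk_vertices w)"
    using trace_props[OF xs(1)] xs(2) distinct_card by metis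
  ultimately show "\<exists>xs c. trace vt T xs c \<and> k \<le> length xs \<and> c \<le> f" using w xs by (intro exI[of _ xs] exI[of _ c]) simp
next
  assume "\<exists>xs c. trace vt T xs c \<and> k \<le> length xs \<and> c \<le> f"
  then obtain xs c where xs: "trace vt T xs c" "k \<le> length xs" "c \<le> f" by blast
  have "card (set xs) = length xs" using trace_props[OF xs(1)] distinct_card by blast
  then show "temporal_orienteering {..<n} T F vs vt k f"
    using trace_imp_walk[OF xs(1)] T_ge_2 xs by (force simp: temporal_orienteering_def)
qed

text \<open>
  \<open>M\<close> marks the vertices that were already matched with a colour; since all colours are
  smaller than \<open>M\<close>, every round matches a new vertex, even if the guessed colours
  \<open>d 1, \<dots>, d k\<close> are not distinct.
\<close>

definition sound_table :: "(nat \<Rightarrow> nat) \<Rightarrow> nat \<Rightarrow> nat \<Rightarrow> (nat \<Rightarrow> nat) \<Rightarrow> bool" where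
  "sound_table h M i R \<longleftrightarrow> (\<forall>t<T. \<forall>v<n. 0 < R (t * n + v) \<longrightarrow>
     (\<exists>xs c. trace v (Suc t) xs c \<and> c + R (t * n + v) \<le> Suc f \<and> i \<le> card {x \<in> set xs. h x = M}))"

text \<open>The index shift between \<open>xs ! j\<close> and \<open>d (Suc j)\<close> arises
  because \<open>d 0\<close> holds the modulus. For \<open>c > f\<close> the truncated difference is
  0 and nothing is demanded.\<close>

definition complete_table :: "(nat \<Rightarrow> nat) \<Rightarrow> nat \<Rightarrow> (nat \<Rightarrow> nat) \<Rightarrow> bool" where
  "complete_table d i R \<longleftrightarrow> (\<forall>v t xs c. trace v (Suc t) xs c \<longrightarrow> i \<le> length xs \<longrightarrow>
     (\<forall>j<i. xs ! j mod d 0 = d (Suc j)) \<longrightarrow> Suc f - c \<le> R (t * n + v))"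

text \<open>A relation restricted to the cells of the table, since the machine's arrays are
  unbounded and the program controls only these cells.\<close>

definition sieved ::
  "nat \<Rightarrow> nat \<Rightarrow> (nat \<Rightarrow> nat) \<Rightarrow> (nat \<Rightarrow> nat) \<Rightarrow> (nat \<Rightarrow> nat) \<Rightarrow> (nat \<Rightarrow> nat) \<Rightarrow> bool" where
  "sieved M col h R h' R' \<longleftrightarrow>
     (\<forall>v<n. h' v = (if h v = col then M else h v)) \<and>
     (\<forall>t<T. \<forall>v<n. R' (t * n + v) = (if h v = col then R (t * n + v) else 0))"

definition hash :: "(nat \<Rightarrow> nat) \<Rightarrow> nat \<Rightarrow> nat \<Rightarrow> (nat \<Rightarrow> nat) \<Rightarrow> bool" where
  "hash d M i h \<longleftrightarrow> (\<forall>v<n. h v = (if v mod d 0 \<in> d ` {1..i} then M else v mod d 0))"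

text \<open>Completeness is claimed for distinct colours only: when a colour is repeated, all
  vertices that carry it are already marked, and the sieve removes them all.\<close>

definition dp :: "(nat \<Rightarrow> nat) \<Rightarrow> nat \<Rightarrow> nat \<Rightarrow> (nat \<Rightarrow> nat) \<Rightarrow> (nat \<Rightarrow> nat) \<Rightarrow> bool" where
  "dp d M i h R \<longleftrightarrow> hash d M i h \<and> sound_table h M i R \<and> (inj_on d {1..k} \<longrightarrow> complete_table d i R)"

section \<open>Preservation of soundness and completeness by relaxation and sieving\<close>

lemma sound_relax1:
  assumes "sound_table h M i R" "t' < T" "t < T" "u < n" "v < n"
  shows "sound_table h M i (relax1 F n t' t u v R)"
proof (cases "F u v (Suc t) (Suc t')")
  case (enat c')
  have lt: "t < t'"
  proof (rule ccontr)
    assume "\<not> t < t'"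
    then have "F u v (Suc t) (Suc t') = \<infinity>" using assms by (intro no_time_travel) auto
    with enat show False by simp
  qed
  define R' where "R' = relax1 F n t' t u v R"
  have R': "R' = R(t' * n + v := max (R (t' * n + v)) (R (t * n + u) - c'))"
    using enat by (simp add: R'_def relax1_def)
  have "sound_table h M i R'"
    unfolding sound_table_def
  proof (intro allI impI)
    fix s x assume sx: "s < T" "x < n" "0 < R' (s * n + x)"
    show "\<exists>xs c. trace x (Suc s) xs c \<and> c + R' (s * n + x) \<le> Suc f \<and> i \<le> card {x \<in> set xs. h x = M}"
    proof (cases "R' (s * n + x) = R (s * n + x)")
      case True
      then show ?thesis using assms(1) sx unfolding sound_table_def by metis
    next
      case False
      then have "s * n + x = t' * n + v" by (auto simp: R' split: if_splits)
      then have "(s * n + x) div n = (t' * n + v) div n" "(s * n + x) mod n = (t' * n + v) mod n"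
        by auto
      then have eq: "s = t'" "x = v" using sx assms by auto
      then have val: "R' (s * n + x) = R (t * n + u) - c'" using False by (auto simp: R' max_def split: if_splits)
      then obtain xs c where xs: "trace u (Suc t) xs c" "c + R (t * n + u) \<le> Suc f"
        "i \<le> card {x \<in> set xs. h x = M}"
        using assms sx(3) unfolding sound_table_def by (metis less_nat_zero_code zero_diff gr0I)
      let ?ys = "if v \<in> set xs then xs else xs @ [v]"
      have "trace v (Suc t') ?ys (c + c')" using xs enat lt assms by (intro step[OF xs(1)]) auto
      moreover have "card {x \<in> set xs. h x = M} \<le> card {x \<in> set ?ys. h x = M}"
        by (intro card_mono) auto
      \<comment> \<open>The new value is positive, hence the truncated subtraction of
        \<open>c'\<close> was exact.\<close>
      moreover have "c + c' + R' (s * n + x) \<le> Suc f" using val xs sx(3) by simp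
      ultimately show ?thesis using xs eq le_trans by blast
    qed
  qed
  then show ?thesis by (simp add: R'_def)
qed (use assms in \<open>simp add: relax1_def\<close>)

lemma sound_relax: "sound_table h M i R \<Longrightarrow> sound_table h M i (relax F n T R)"
  by (rule relax_invariant[where P = "sound_table h M i"]) (auto intro: sound_relax1)

lemma relax_trace_step:
  assumes "trace u t xs c" "v < n" "t < t'" "t' \<le> T" "F u v t t' = enat c'"
    and "Suc f - c \<le> relax F n T R ((t - 1) * n + u)"
  shows "Suc f - (c + c') \<le> relax F n T R ((t' - 1) * n + v)"
proof -
  note p = trace_props[OF assms(1)]
  obtain s s' where "t = Suc s" "t' = Suc s'" using p assms(3) by (metis Suc_le_D One_nat_def less_imp_Suc_add)
  then show ?thesis using relax_step[of s s' T u n v F c' R] p assms by simp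
qed

lemma complete_0:
  assumes "Suc f \<le> R vs"
  shows "complete_table d 0 (relax F n T R)"
proof -
  have "Suc f - c \<le> relax F n T R ((t - 1) * n + v)" if "trace v t xs c" for v t xs c
    using that
  proof (induction rule: trace.induct)
    case start
    show ?case using assms relax_mono[of R vs F n T] by simp
  next
    case (step u t xs c v t' c')
    then show ?case
      by (intro relax_trace_step[OF step.hyps])
  qed
  from this[where t = "Suc _"] show ?thesis unfolding complete_table_def by simp
qed

text \<open>Consider the move of a trace that first visits its \<open>(i+1)\<close>-st distinct
  vertex. The trace then stands at that vertex, whose colour is \<open>d (Suc i)\<close>, so the
  sieve keeps the cell; from there on, relaxation follows the remaining moves.\<close>

lemma complete_Suc:
  assumes R: "complete_table d i R"
    and R': "\<And>t v. t < T \<Longrightarrow> v < n \<Longrightarrow> v mod d 0 = d (Suc i) \<Longrightarrow> R (t * n + v) \<le> R' (t * n + v)"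
  shows "complete_table d (Suc i) (relax F n T R')"
proof -
  \<comment> \<open>The moment of the match: the list has exactly \<open>Suc i\<close> entries and
    ends in the current vertex \<open>v\<close>.\<close>
  have new: "Suc f - c \<le> relax F n T R' ((t - 1) * n + v)"
    if "trace v t xs c" "length xs = Suc i" "last xs = v" "\<forall>j<Suc i. xs ! j mod d 0 = d (Suc j)" for v t xs c
  proof -
    note p = trace_props[OF that(1)]
    have "Suc f - c \<le> R ((t - 1) * n + v)" using R that p unfolding complete_table_def by simp
    also have "xs ! i = v" using that by (metis last_conv_nth diff_Suc_1 list.size(3) nat.simps(3))
    then have "R ((t - 1) * n + v) \<le> R' ((t - 1) * n + v)" using that p by (intro R') auto
    also have "\<dots> \<le> relax F n T R' ((t - 1) * n + v)" by (rule relax_mono)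
    finally show ?thesis .
  qed
  have "Suc i \<le> length xs \<Longrightarrow> \<forall>j<Suc i. xs ! j mod d 0 = d (Suc j) \<Longrightarrow>
      Suc f - c \<le> relax F n T R' ((t - 1) * n + v)" if "trace v t xs c" for v t xs c
    using that
  proof (induction rule: trace.induct)
    case start
    then show ?case using new[OF trace.start] by simp
  next
    case (step u t xs c v t' c')
    let ?ys = "if v \<in> set xs then xs else xs @ [v]"
    show ?case
    proof (cases "Suc i \<le> length xs")
      case True
      then have "\<forall>j<Suc i. xs ! j mod d 0 = d (Suc j)"
        using step.prems(2) by (auto simp: nth_append split: if_splits)
      with True step.IH show ?thesis by (intro relax_trace_step[OF step.hyps])
    next
      \<comment> \<open>The move itself brings the list to length \<open>Suc i\<close>, so
        \<open>v\<close> is the vertex to be matched.\<close>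
      case False
      then have "v \<notin> set xs" "length ?ys = Suc i" using step.prems by (auto split: if_splits)
      then show ?thesis using step.prems by (intro new[OF trace.step[OF step.hyps]]) auto
    qed
  qed
  from this[where t = "Suc _"] show ?thesis unfolding complete_table_def by simp
qed

lemma dp_start:
  assumes "\<And>v. v < n \<Longrightarrow> h v = v mod d 0"
    and R: "\<And>t v. t < T \<Longrightarrow> v < n \<Longrightarrow> R (t * n + v) = (if t = 0 \<and> v = vs then Suc f else 0)"
  shows "dp d M 0 h (relax F n T R)"
  unfolding dp_def
proof (intro conjI impI)
  show "hash d M 0 h" using assms by (simp add: hash_def)
  have "trace vs (Suc 0) [vs] 0" using start by simp
  then show "sound_table h M 0 (relax F n T R)"
    by (intro sound_relax) (auto simp: sound_table_def R intro!: exI)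
  show "complete_table d 0 (relax F n T R)"
    using R[of 0 vs] T_ge_2 source by (intro complete_0) simp
qed

lemma dp_round:
  assumes dp: "dp d M i h R" and i: "i < k" and col: "d (Suc i) < M"
    and sieved: "sieved M (d (Suc i)) h R h' R'"
  shows "dp d M (Suc i) h' (relax F n T R')"
  unfolding dp_def
proof (intro conjI impI)
  have hash: "hash d M i h" and sound: "sound_table h M i R" using dp by (auto simp: dp_def)
  show "hash d M (Suc i) h'"
    using hash sieved col by (auto simp: hash_def sieved_def atLeastAtMostSuc_conv)
  show "sound_table h' M (Suc i) (relax F n T R')"
  proof (rule sound_relax, unfold sound_table_def, intro allI impI)
    fix t v assume tv: "t < T" "v < n" "0 < R' (t * n + v)"
    then have h: "h v = d (Suc i)" and R': "R' (t * n + v) = R (t * n + v)"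
      using sieved by (auto simp: sieved_def split: if_splits)
    with tv sound obtain xs c where xs: "trace v (Suc t) xs c" "c + R' (t * n + v) \<le> Suc f"
      "i \<le> card {x \<in> set xs. h x = M}" unfolding sound_table_def by metis
    note p = trace_props[OF xs(1)]
    \<comment> \<open>As \<open>h v = d (Suc i) < M\<close>, the vertex \<open>v\<close> is not yet
      marked, and marking it raises the count by at least one.\<close>
    have "Suc (card {x \<in> set xs. h x = M}) = card (insert v {x \<in> set xs. h x = M})"
      using h col by simp
    also have "\<dots> \<le> card {x \<in> set xs. h' x = M}"
      using p h sieved by (intro card_mono) (auto simp: sieved_def subset_iff)
    finally show "\<exists>xs c. trace v (Suc t) xs c \<and> c + R' (t * n + v) \<le> Suc f \<and>
        Suc i \<le> card {x \<in> set xs. h' x = M}" using xs by fastforce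
  qed
  assume inj: "inj_on d {1..k}"
  show "complete_table d (Suc i) (relax F n T R')"
  proof (rule complete_Suc)
    show "complete_table d i R" using dp inj by (simp add: dp_def)
    fix t v assume tv: "t < T" "v < n" "v mod d 0 = d (Suc i)"
    \<comment> \<open>With distinct colours no earlier round has overwritten the vertices of colour
      \<open>d (Suc i)\<close>.\<close>
    have "d (Suc i) \<notin> d ` {1..i}"
      using inj_on_contraD[OF inj, of "Suc i"] i by (auto simp: image_iff)
    then have "h v = d (Suc i)" using hash tv by (simp add: hash_def)
    then show "R (t * n + v) \<le> R' (t * n + v)" using sieved tv by (simp add: sieved_def)
  qed
qed

lemma dp_accept_sound:
  assumes "dp d M k h R" and "0 < R ((T - 1) * n + vt)"
  shows "temporal_orienteering {..<n} T F vs vt k f"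
proof -
  have "T - 1 < T" "Suc (T - 1) = T" using T_ge_2 by auto
  moreover have "sound_table h M k R" using assms by (simp add: dp_def)
  ultimately obtain xs c where xs: "trace vt T xs c" "c + R ((T - 1) * n + vt) \<le> Suc f"
    "k \<le> card {x \<in> set xs. h x = M}"
    using assms(2) sink unfolding sound_table_def by metis
  have "card {x \<in> set xs. h x = M} \<le> card (set xs)" by (intro card_mono) auto
  also have "\<dots> \<le> length xs" by (rule card_length)
  finally show ?thesis using xs assms(2) unfolding orienteering_iff_trace
    by (intro exI[of _ xs] exI[of _ c]) auto
qed

text \<open>The good guess consists of a modulus separating the first \<open>k\<close> vertices of a
  solution and of their residues. Collisions with later vertices are harmless, since completeness
  inspects only the first \<open>k\<close> entries of the list.\<close>

lemma dp_accept_complete: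
  assumes "temporal_orienteering {..<n} T F vs vt k f" and "n \<le> 2 ^ L"
  shows "\<exists>d. (\<forall>i\<le>k. d i < 3 + k * k * L) \<and>
    (\<forall>M h R. dp d M k h R \<longrightarrow> 0 < R ((T - 1) * n + vt))"
proof -
  obtain xs c where xs: "trace vt T xs c" "k \<le> length xs" "c \<le> f"
    using assms orienteering_iff_trace by auto
  note p = trace_props[OF xs(1)]
  have "set (take k xs) \<subseteq> {..<n}" using p by (meson order_trans set_take_subset)
  moreover have "card (set (take k xs)) \<le> k" by (rule order_trans[OF card_length]) simp
  ultimately obtain m where m: "0 < m" "m < 3 + k * k * L" "inj_on (\<lambda>x. x mod m) (set (take k xs))"
    using separating_modulus assms(2) by blast
  define d where "d i = (case i of 0 \<Rightarrow> m | Suc j \<Rightarrow> xs ! j mod m)" for i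
  have bound: "d i < 3 + k * k * L" for i
    using m by (auto simp: d_def split: nat.split intro: less_trans[OF mod_less_divisor])
  have inj: "inj_on d {1..k}"
  proof (rule inj_onI)
    fix a b assume ab: "a \<in> {1..k}" "b \<in> {1..k}" "d a = d b"
    then obtain a' b' where [simp]: "a = Suc a'" "b = Suc b'" by (metis Suc_le_D atLeastAtMost_iff One_nat_def)
    have "a' < length (take k xs)" "b' < length (take k xs)" using ab xs by auto
    then have mem: "xs ! a' \<in> set (take k xs)" "xs ! b' \<in> set (take k xs)"
      by (metis nth_mem nth_take length_take min_less_iff_conj)+
    have "xs ! a' = xs ! b'" using inj_onD[OF m(3) _ mem] ab by (simp add: d_def)
    then show "a = b" using p ab xs nth_eq_iff_index_eq by fastforce
  qed
  have "0 < R ((T - 1) * n + vt)" if "dp d M k h R" for M h R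
  proof -
    have "complete_table d k R" using that inj by (simp add: dp_def)
    moreover have "trace vt (Suc (T - 1)) xs c" using xs T_ge_2 by simp
    moreover have "\<forall>j<k. xs ! j mod d 0 = d (Suc j)" by (simp add: d_def)
    ultimately have "Suc f - c \<le> R ((T - 1) * n + vt)" using xs unfolding complete_table_def by blast
    then show ?thesis using xs by simp
  qed
  with bound show ?thesis by blast
qed

end

section \<open>Timed program logic\<close>

fun regs :: "prog \<Rightarrow> name set" where
  "regs (Assign x e) = {x}"
| "regs (Seq p q) = regs p \<union> regs q"
| "regs (Cond e p q) = regs p \<union> regs q"
| "regs (Loop e p) = regs p"
| "regs _ = {}"

fun arrs :: "prog \<Rightarrow> name set" where
  "arrs (Write a i e) = {a}"
| "arrs (Seq p q) = arrs p \<union> arrs q"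
| "arrs (Cond e p q) = arrs p \<union> arrs q"
| "arrs (Loop e p) = arrs p"
| "arrs _ = {}"

definition frame :: "prog \<Rightarrow> state \<Rightarrow> state \<Rightarrow> bool" where
  "frame p s s' \<longleftrightarrow>
     (\<forall>x. x \<notin> regs p \<longrightarrow> fst s' x = fst s x) \<and> (\<forall>a. a \<notin> arrs p \<longrightarrow> snd s' a = snd s a)"

lemma frame_reg: "frame p s s' \<Longrightarrow> x \<notin> regs p \<Longrightarrow> fst s' x = fst s x"
  by (simp add: frame_def)

lemma frame_arr: "frame p s s' \<Longrightarrow> a \<notin> arrs p \<Longrightarrow> snd s' a = snd s a"
  by (simp add: frame_def)

lemma exec_frame: "exec F p s m s' \<Longrightarrow> frame p s s'"
  by (induction rule: exec.induct) (auto simp: frame_def)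

text \<open>Total correctness with a step budget. An upper bound \<open>B\<close> instead of an
  exact count lets branches of different length share one statement; one run suffices because
  execution is deterministic.\<close>

definition runs :: "cost_oracle \<Rightarrow> prog \<Rightarrow> state \<Rightarrow> nat \<Rightarrow> (state \<Rightarrow> bool) \<Rightarrow> bool" where
  "runs F p s B Q \<longleftrightarrow> (\<exists>m s'. exec F p s m s' \<and> m \<le> B \<and> Q s')"

lemma runsI: "exec F p s m s' \<Longrightarrow> m \<le> B \<Longrightarrow> Q s' \<Longrightarrow> runs F p s B Q"
  unfolding runs_def by blast

lemma runsE:
  assumes "runs F p s B Q"
  obtains m s' where "exec F p s m s'" "m \<le> B" "Q s'"
  using assms unfolding runs_def by blast

text \<open>The consequence rule also supplies \<open>frame\<close>, so postconditions may omit all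
  that the program does not write.\<close>

lemma runs_weaken:
  assumes "runs F p s B P" "\<And>s'. frame p s s' \<Longrightarrow> P s' \<Longrightarrow> Q s'" "B \<le> B'"
  shows "runs F p s B' Q"
  using assms unfolding runs_def by (meson exec_frame order_trans)

lemma runs_Skip [simp]: "runs F Skip s B Q \<longleftrightarrow> 1 \<le> B \<and> Q s"
  (is "?l \<longleftrightarrow> ?r")
proof
  show "?l \<Longrightarrow> ?r" by (auto elim!: runsE SkipE)
  show "?r \<Longrightarrow> ?l" by (rule runsI[OF exec.Skip]) auto
qed

text \<open>An equivalence, like its companions, so that the simplifier executes straight-line code
  symbolically and checks the remaining budget.\<close>

lemma runs_Assign [simp]:
  "runs F (Assign x e) s B Q \<longleftrightarrow> 1 + expr_time e \<le> B \<and> Q ((fst s)(x := expr_val F s e), snd s)"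
  (is "?l \<longleftrightarrow> ?r")
proof
  show "?l \<Longrightarrow> ?r" by (auto elim!: runsE AssignE)
  show "?r \<Longrightarrow> ?l" by (rule runsI[OF exec.Assign]) auto
qed

lemma runs_Write [simp]:
  "runs F (Write a i e) s B Q \<longleftrightarrow> 1 + expr_time i + expr_time e \<le> B \<and>
     Q (fst s, (snd s)(a := (snd s a)(expr_val F s i := expr_val F s e)))"
  (is "?l \<longleftrightarrow> ?r")
proof
  show "?l \<Longrightarrow> ?r" by (auto elim!: runsE WriteE)
  show "?r \<Longrightarrow> ?l" by (rule runsI[OF exec.Write]) auto
qed

lemma runs_Cond [simp]:
  "runs F (Cond e p q) s B Q \<longleftrightarrow> 1 + expr_time e \<le> B \<and>
     (if expr_val F s e \<noteq> 0 then runs F p s (B - (1 + expr_time e)) Q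
      else runs F q s (B - (1 + expr_time e)) Q)" (is "?l \<longleftrightarrow> ?r")
proof
  assume ?l
  then obtain m s' where m: "exec F (Cond e p q) s m s'" "m \<le> B" "Q s'" by (rule runsE)
  from m(1) show ?r
    by (rule CondE) (use m in \<open>auto intro: runsI\<close>)
next
  assume r: ?r
  show ?l
  proof (cases "expr_val F s e = 0")
    case True
    with r have "runs F q s (B - (1 + expr_time e)) Q" by simp
    then obtain m s' where m: "exec F q s m s'" "m \<le> B - (1 + expr_time e)" "Q s'"
      by (rule runsE)
    show ?thesis by (rule runsI[OF exec.CondFalse[OF True m(1)]]) (use r m in auto)
  next
    case False
    with r have "runs F p s (B - (1 + expr_time e)) Q" by simp
    then obtain m s' where m: "exec F p s m s'" "m \<le> B - (1 + expr_time e)" "Q s'"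
      by (rule runsE)
    show ?thesis by (rule runsI[OF exec.CondTrue[OF False m(1)]]) (use r m in auto)
  qed
qed

lemma runs_Seq:
  assumes "runs F p s Bp P" "\<And>s'. frame p s s' \<Longrightarrow> P s' \<Longrightarrow> runs F q s' Bq Q" "Bp + Bq \<le> B"
  shows "runs F (Seq p q) s B Q"
proof -
  from assms(1) obtain m s' where 1: "exec F p s m s'" "m \<le> Bp" "P s'" by (rule runsE)
  from assms(2)[OF exec_frame[OF 1(1)] 1(3)] obtain m' s''
    where 2: "exec F q s' m' s''" "m' \<le> Bq" "Q s''" by (rule runsE)
  show ?thesis by (rule runsI[OF exec.Seq[OF 1(1) 2(1)]]) (use 1 2 assms(3) in auto)
qed

lemma runs_SeqE:
  assumes "runs F (Seq p q) s B Q"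
  obtains m m' s' s'' where "exec F p s m s'" "exec F q s' m' s''" "m + m' \<le> B" "Q s''"
  using assms by (blast elim: runsE SeqE)

lemma runs_Seq_Assign [simp]:
  "runs F (Seq (Assign x e) q) s B Q \<longleftrightarrow> 1 + expr_time e \<le> B \<and>
     runs F q ((fst s)(x := expr_val F s e), snd s) (B - (1 + expr_time e)) Q" (is "?l \<longleftrightarrow> ?r")
proof
  show "?l \<Longrightarrow> ?r"
    by (auto elim!: runs_SeqE AssignE intro: runsI)
  show "?r \<Longrightarrow> ?l"
    by (rule runs_Seq[where P = "(=) ((fst s)(x := expr_val F s e), snd s)" and Bp = "1 + expr_time e"]) auto
qed

lemma runs_Seq_Write [simp]:
  "runs F (Seq (Write a i e) q) s B Q \<longleftrightarrow> 1 + expr_time i + expr_time e \<le> B \<and>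
     runs F q (fst s, (snd s)(a := (snd s a)(expr_val F s i := expr_val F s e)))
       (B - (1 + expr_time i + expr_time e)) Q" (is "?l \<longleftrightarrow> ?r")
proof
  show "?l \<Longrightarrow> ?r"
    by (auto elim!: runs_SeqE WriteE intro: runsI)
  show "?r \<Longrightarrow> ?l"
    by (rule runs_Seq[where P = "(=) (fst s, (snd s)(a := (snd s a)(expr_val F s i := expr_val F s e)))"
          and Bp = "1 + expr_time i + expr_time e"]) auto
qed

text \<open>The index \<open>i\<close> of the invariant counts iterations, and the test must fail
  exactly at \<open>i = N\<close>. Induction on \<open>N - i\<close>; the last summands of the
  budget pay for the failing test.\<close>

lemma runs_Loop:
  assumes init: "I i s" and "i \<le> N"
    and test: "\<And>i s. i \<le> N \<Longrightarrow> I i s \<Longrightarrow> expr_val F s e = 0 \<longleftrightarrow> i = N"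
    and step: "\<And>i s. i < N \<Longrightarrow> I i s \<Longrightarrow> runs F p s B (I (Suc i))"
    and B': "(N - i) * (B + expr_time e + 1) + expr_time e + 1 \<le> B'"
  shows "runs F (Loop e p) s B' (I N)"
proof -
  have "runs F (Loop e p) s ((N - i) * (B + expr_time e + 1) + expr_time e + 1) (I N)"
    using init \<open>i \<le> N\<close>
  proof (induction "N - i" arbitrary: i s)
    case 0
    then have "expr_val F s e = 0" using test[of i s] by simp
    then show ?case using 0 by (intro runsI[OF exec.LoopFalse]) auto
  next
    case (Suc r)
    then have i: "i < N" by simp
    from step[OF this Suc.prems(1)] obtain m s' where 1: "exec F p s m s'" "m \<le> B" "I (Suc i) s'"
      by (rule runsE)
    have "runs F (Loop e p) s' ((N - Suc i) * (B + expr_time e + 1) + expr_time e + 1) (I N)"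
      using Suc.hyps 1 i by (intro Suc.hyps(1)) auto
    then obtain m' s'' where 2: "exec F (Loop e p) s' m' s''"
      "m' \<le> (N - Suc i) * (B + expr_time e + 1) + expr_time e + 1" "I N s''"
      by (rule runsE)
    have "N - i = Suc (N - Suc i)" using i by simp
    moreover have "exec F (Loop e p) s (1 + expr_time e + m + m') s''"
      using exec.LoopTrue[OF _ 1(1) 2(1)] test[of i s] i Suc.prems by simp
    ultimately show ?case
      using 1 2 by (intro runsI) auto
  qed
  then show ?thesis by (rule runs_weaken) (use B' in auto)
qed

definition For :: "name \<Rightarrow> expr \<Rightarrow> prog \<Rightarrow> prog" where
  "For x e p = Seq (Assign x (Const 0))
     (Loop (Minus e (Reg x)) (Seq p (Assign x (Plus (Reg x) (Const 1)))))"

lemma regs_For [simp]: "regs (For x e p) = insert x (regs p)"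
  and arrs_For [simp]: "arrs (For x e p) = arrs p"
  by (auto simp: For_def)

text \<open>The bound \<open>e\<close> is evaluated anew at every test and must stay
  \<open>N\<close>. Per iteration, 4 steps increment the counter and \<open>expr_time e + 3\<close>
  steps test it; initialisation and the final test take \<open>expr_time e + 5\<close>.\<close>

lemma runs_For:
  assumes x: "x \<notin> regs p"
    and bound: "\<And>s'. frame (For x e p) s s' \<Longrightarrow> expr_val F s' e = N"
    and init: "I 0 ((fst s)(x := 0), snd s)"
    and step: "\<And>i s'. i < N \<Longrightarrow> frame (For x e p) s s' \<Longrightarrow> fst s' x = i \<Longrightarrow> I i s' \<Longrightarrow>
       runs F p s' B (\<lambda>s''. I (Suc i) ((fst s'')(x := Suc i), snd s''))"
    and B': "N * (B + expr_time e + 7) + expr_time e + 5 \<le> B'"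
  shows "runs F (For x e p) s B' (I N)"
  unfolding For_def
proof (rule runs_Seq[where P = "\<lambda>s'. s' = ((fst s)(x := 0), snd s)"])
  show "runs F (Assign x (Const 0)) s 2 (\<lambda>s'. s' = ((fst s)(x := 0), snd s))" by simp
  fix s1 :: state
  assume s1: "s1 = ((fst s)(x := 0), snd s)"
  define J where "J i s' \<longleftrightarrow> frame (For x e p) s s' \<and> fst s' x = i \<and> I i s'" for i s'
  have "runs F (Loop (Minus e (Reg x)) (Seq p (Assign x (Plus (Reg x) (Const 1))))) s1
     (B' - 2) (J N)"
  proof (rule runs_Loop[where i = 0 and I = J])
    show "J 0 s1" using init by (auto simp: J_def s1 frame_def)
    show "(expr_val F s' (Minus e (Reg x)) = 0) = (i = N)" if "i \<le> N" "J i s'" for i s'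
      using that bound by (auto simp: J_def)
    show "runs F (Seq p (Assign x (Plus (Reg x) (Const 1)))) s' (B + 4) (J (Suc i))"
      if i: "i < N" and J: "J i s'" for i s'
    proof (rule runs_Seq)
      show "runs F p s' B (\<lambda>s''. I (Suc i) ((fst s'')(x := Suc i), snd s''))"
        using step i J by (auto simp: J_def)
      fix s2 assume fr: "frame p s' s2" and I: "I (Suc i) ((fst s2)(x := Suc i), snd s2)"
      have "fst s2 x = i" using fr x J by (simp add: frame_def J_def)
      then show "runs F (Assign x (Plus (Reg x) (Const 1))) s2 4 (J (Suc i))"
        using I J fr by (auto simp: J_def frame_def)
    qed simp
    show "(N - 0) * (B + 4 + expr_time (Minus e (Reg x)) + 1) + expr_time (Minus e (Reg x)) + 1 \<le> B' - 2"
      using B' by (simp add: algebra_simps)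
  qed simp
  then show "runs F (Loop (Minus e (Reg x)) (Seq p (Assign x (Plus (Reg x) (Const 1))))) s1
     (B' - 2) (I N)"
    by (rule runs_weaken) (auto simp: J_def)
qed (use B' in simp)

lemma runs_For_fold:
  assumes "x \<notin> regs p"
    and "\<And>s'. frame (For x e p) s s' \<Longrightarrow> expr_val F s' e = N"
    and step: "\<And>i s'. i < N \<Longrightarrow> frame (For x e p) s s' \<Longrightarrow> fst s' x = i \<Longrightarrow>
       runs F p s' B (\<lambda>s''. snd s'' a = g i (snd s' a))"
    and "N * (B + expr_time e + 7) + expr_time e + 5 \<le> B'"
  shows "runs F (For x e p) s B' (\<lambda>s'. snd s' a = fold g [0..<N] (snd s a))"
  by (rule runs_For[where I = "\<lambda>i s'. snd s' a = fold g [0..<i] (snd s a)" and B = B])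
    (use assms in \<open>auto intro: runs_weaken[OF step]\<close>)

text \<open>For a register bound, each iteration costs 8 extra steps; since \<open>N >= 1\<close>,
  the constant 6 is charged to the iterations as well, giving 14.\<close>

lemma linear_loop_bound:
  assumes "1 \<le> N" and "B + 14 \<le> B'"
  shows "N * (B + expr_time (Reg y) + 7) + expr_time (Reg y) + 5 \<le> N * B'"
proof -
  have "N * (B + 14) \<le> N * B'" using assms(2) by (rule mult_le_mono2)
  then show ?thesis using assms(1) by (simp add: distrib_left)
qed

section \<open>The program\<close>

definition neq :: "expr \<Rightarrow> expr \<Rightarrow> expr" where
  "neq a b = Plus (Minus a b) (Minus b a)"

lemma neq_val [simp]: "expr_val F s (neq a b) = 0 \<longleftrightarrow> expr_val F s a = expr_val F s b"
  by (auto simp: neq_def)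

lemma neq_time [simp]: "expr_time (neq a b) = 3 + 2 * (expr_time a + expr_time b)"
  by (simp add: neq_def)

text \<open>The machine does not multiply, so the row offsets \<open>t * n\<close> are precomputed
  in the array \<open>W\<close>.\<close>

definition cell :: "expr \<Rightarrow> expr \<Rightarrow> expr" where
  "cell t v = Plus (Read ''W'' t) v"

text \<open>A lookup yields \<open>c + 1\<close>, which is compensated by adding 1 before
  subtracting. The maximum of \<open>old\<close> and \<open>x\<close> is computed as
  \<open>old + (x - old)\<close> with truncated subtraction. Register \<open>s\<close> holds the
  departure row, \<open>t\<close> the arrival row.\<close>

definition relax_body :: prog where
  "relax_body =
     (let t = Reg ''t''; s = Reg ''s''; u = Reg ''u''; v = Reg ''v'';
          cost = Lookup u v (Plus s (Const 1)) (Plus t (Const 1));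
          old = Read ''R'' (cell t v)
      in Cond cost
           (Write ''R'' (cell t v)
              (Plus old (Minus (Minus (Plus (Read ''R'' (cell s u)) (Const 1)) cost) old)))
           Skip)"

definition relax_prog :: prog where
  "relax_prog = For ''t'' (Reg ''T'') (For ''s'' (Reg ''T'')
     (For ''u'' (Reg ''n'') (For ''v'' (Reg ''n'') relax_body)))"

definition clear_prog :: prog where
  "clear_prog = For ''t'' (Reg ''T'') (Write ''R'' (cell (Reg ''t'') (Reg ''v'')) (Const 0))"

definition sieve_prog :: prog where
  "sieve_prog = For ''v'' (Reg ''n'')
     (Cond (neq (Read ''h'' (Reg ''v'')) (Read ''d'' (Plus (Reg ''i'') (Const 1))))
        clear_prog
        (Write ''h'' (Reg ''v'') (Reg ''M'')))"

text \<open>Residues come from a cyclic counter \<open>r\<close>. For \<open>d 0 = 0\<close> the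
  counter is never reset, in agreement with \<open>v mod 0 = v\<close>.\<close>

definition hash_prog :: prog where
  "hash_prog = Seq (Assign ''r'' (Const 0)) (For ''v'' (Reg ''n'')
     (Seq (Write ''h'' (Reg ''v'') (Reg ''r''))
       (Seq (Assign ''r'' (Plus (Reg ''r'') (Const 1)))
         (Cond (neq (Reg ''r'') (Read ''d'' (Const 0))) Skip (Assign ''r'' (Const 0))))))"

text \<open>
  The guess is the array \<open>d\<close>: entry 0 is the modulus of the hash function, entries 1 to \<open>k\<close> are
  the colours of the vertices in the order of their first visits.
\<close>

definition trial_prog :: prog where
  "trial_prog = Seq hash_prog (Seq (For ''v'' (Reg ''n'') clear_prog)
     (Seq (Write ''R'' (Reg ''source'') (Plus (Reg ''budget'') (Const 1)))
       (Seq relax_prog (Seq (For ''i'' (Reg ''k'') (Seq sieve_prog relax_prog))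
         (Cond (Read ''R'' (cell (Minus (Reg ''T'') (Const 1)) (Reg ''sink'')))
            (Assign ''answer'' (Const 1)) Skip)))))"

text \<open>The array \<open>d\<close> is incremented as a number in base \<open>M\<close>; the final carry ends the main loop.\<close>

definition increment_prog :: prog where
  "increment_prog = Seq (Assign ''c'' (Const 1)) (For ''i'' (Plus (Reg ''k'') (Const 1))
     (Seq (Write ''d'' (Reg ''i'') (Plus (Read ''d'' (Reg ''i'')) (Reg ''c'')))
        (Cond (neq (Read ''d'' (Reg ''i'')) (Reg ''M''))
           (Assign ''c'' (Const 0))
           (Write ''d'' (Reg ''i'') (Const 0)))))"

definition log_prog :: prog where
  "log_prog = Seq (Assign ''p'' (Const 1)) (Loop (Minus (Reg ''n'') (Reg ''p''))
     (Seq (Assign ''p'' (Plus (Reg ''p'') (Reg ''p''))) (Assign ''L'' (Plus (Reg ''L'') (Const 1)))))"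

text \<open>Computes \<open>3 + k * k * L\<close> by repeated addition.\<close>

definition modulus_prog :: prog where
  "modulus_prog = Seq (Assign ''M'' (Const 3)) (For ''i'' (Reg ''k'') (For ''j'' (Reg ''k'')
     (Assign ''M'' (Plus (Reg ''M'') (Reg ''L'')))))"

definition offset_prog :: prog where
  "offset_prog = For ''t'' (Reg ''T'') (Write ''W'' (Plus (Reg ''t'') (Const 1))
     (Plus (Read ''W'' (Reg ''t'')) (Reg ''n'')))"

definition orienteering_prog :: prog where
  "orienteering_prog = Seq log_prog (Seq modulus_prog (Seq offset_prog
     (Loop (Minus (Const 1) (Reg ''c'')) (Seq trial_prog increment_prog))))"

lemmas prog_defs = relax_body_def relax_prog_def clear_prog_def sieve_prog_def hash_prog_def
  trial_prog_def increment_prog_def log_prog_def modulus_prog_def offset_prog_def Let_def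

lemma cell_eq_iff:
  fixes v w n t s :: nat
  assumes "v < n" "w < n"
  shows "t * n + v = s * n + w \<longleftrightarrow> t = s \<and> v = w"
proof
  assume eq: "t * n + v = s * n + w"
  from arg_cong[OF eq, of "\<lambda>x. x div n"] arg_cong[OF eq, of "\<lambda>x. x mod n"]
  show "t = s \<and> v = w" using assms by simp
qed simp

text \<open>A digit plus an incoming carry is at most \<open>M\<close>, so the program detects an
  outgoing carry by an equality test.\<close>

lemma carry:
  fixes a c M :: nat
  assumes "2 \<le> M" "c \<le> 1"
  shows "a mod M + c = M \<Longrightarrow> (a + c) mod M = 0 \<and> (a + c) div M = Suc (a div M)"
    and "a mod M + c \<noteq> M \<Longrightarrow> (a + c) mod M = a mod M + c \<and> (a + c) div M = a div M"
proof -
  have eq: "a + c = a div M * M + (a mod M + c)" by (metis add.assoc div_mult_mod_eq)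
  show "(a + c) mod M = 0 \<and> (a + c) div M = Suc (a div M)" if "a mod M + c = M"
  proof -
    have "a + c = Suc (a div M) * M" using eq that by simp
    then show ?thesis using assms by simp
  qed
  show "(a + c) mod M = a mod M + c \<and> (a + c) div M = a div M" if "a mod M + c \<noteq> M"
  proof -
    have "a mod M < M" using assms by simp
    then have "a mod M + c < M" using that assms(2) by linarith
    moreover have "(q * M + x) mod M = x \<and> (q * M + x) div M = q" if "x < M" for q x
      using that by simp
    ultimately show ?thesis unfolding eq by blast
  qed
qed

section \<open>Correctness and step counts of the subprograms\<close>

context orienteering_instance
begin

text \<open>Collects what is fixed before the main loop and only read within it, so that a single
  frame argument carries it through each subprogram.\<close>

definition env :: "nat \<Rightarrow> state \<Rightarrow> bool" where
  "env M s \<longleftrightarrow> fst s ''n'' = n \<and> fst s ''T'' = T \<and> fst s ''source'' = vs \<and> fst s ''sink'' = vt \<and>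
     fst s ''k'' = k \<and> fst s ''budget'' = f \<and> fst s ''M'' = M \<and> (\<forall>t<T. snd s ''W'' t = t * n)"

lemma env_frame:
  assumes "frame p s s'" "env M s"
    and "regs p \<inter> {''n'', ''T'', ''source'', ''sink'', ''k'', ''budget'', ''M''} = {}" "''W'' \<notin> arrs p"
  shows "env M s'"
proof -
  have "fst s' x = fst s x" if "x \<in> {''n'', ''T'', ''source'', ''sink'', ''k'', ''budget'', ''M''}" for x
    by (rule frame_reg[OF assms(1)]) (use that assms(3) in blast)
  then show ?thesis using assms(2) frame_arr[OF assms(1,4)] by (simp add: env_def)
qed

lemma env_upd [simp]:
  "x \<notin> {''n'', ''T'', ''source'', ''sink'', ''k'', ''budget'', ''M''} \<Longrightarrow> env M (r(x := y), a) = env M (r, a)"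
  by (auto simp: env_def)

lemma n_pos: "1 \<le> n" and T_pos: "1 \<le> T"
  using source T_ge_2 by auto

text \<open>The step counts are generous round numbers; in the nested loops each level adds 14 per
  iteration, beginning with \<open>74 = 60 + 14\<close>.\<close>

lemma relax_body_runs:
  assumes "env M s" "fst s ''t'' < T" "fst s ''s'' < T"
  shows "runs F relax_body s 60
    (\<lambda>s'. snd s' ''R'' = relax1 F n (fst s ''t'') (fst s ''s'') (fst s ''u'') (fst s ''v'') (snd s ''R''))"
  using assms
  by (cases "F (fst s ''u'') (fst s ''v'') (Suc (fst s ''s'')) (Suc (fst s ''t''))")
    (auto simp: relax_body_def Let_def cell_def env_def relax1_def max_def fun_eq_iff)

lemma relax_v_runs:
  assumes "env M s" "fst s ''t'' < T" "fst s ''s'' < T"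
  shows "runs F (For ''v'' (Reg ''n'') relax_body) s (n * 74)
    (\<lambda>s'. snd s' ''R'' =
       fold (relax1 F n (fst s ''t'') (fst s ''s'') (fst s ''u'')) [0..<n] (snd s ''R''))"
proof (rule runs_For_fold)
  fix i s' assume fr: "frame (For ''v'' (Reg ''n'') relax_body) s s'" and i: "fst s' ''v'' = i"
  have "env M s'" by (rule env_frame[OF fr assms(1)]) (simp_all add: prog_defs)
  moreover have "fst s' ''t'' = fst s ''t''" "fst s' ''s'' = fst s ''s''" "fst s' ''u'' = fst s ''u''"
    by (simp_all add: frame_reg[OF fr] prog_defs)
  ultimately show "runs F relax_body s' 60 (\<lambda>s''. snd s'' ''R'' =
      relax1 F n (fst s ''t'') (fst s ''s'') (fst s ''u'') i (snd s' ''R''))"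
    using relax_body_runs[of M s'] assms i by simp
next
  fix s' assume fr: "frame (For ''v'' (Reg ''n'') relax_body) s s'"
  have "env M s'" by (rule env_frame[OF fr assms(1)]) (simp_all add: prog_defs)
  then show "expr_val F s' (Reg ''n'') = n" by (simp add: env_def)
qed (rule linear_loop_bound[OF n_pos] | simp add: prog_defs)+

lemma relax_u_runs:
  assumes "env M s" "fst s ''t'' < T" "fst s ''s'' < T"
  shows "runs F (For ''u'' (Reg ''n'') (For ''v'' (Reg ''n'') relax_body)) s (n * (n * 74 + 14))
    (\<lambda>s'. snd s' ''R'' = fold (\<lambda>u. fold (relax1 F n (fst s ''t'') (fst s ''s'') u) [0..<n]) [0..<n]
       (snd s ''R''))"
proof (rule runs_For_fold)
  fix i s' assume fr: "frame (For ''u'' (Reg ''n'') (For ''v'' (Reg ''n'') relax_body)) s s'"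
    and i: "fst s' ''u'' = i"
  have "env M s'" by (rule env_frame[OF fr assms(1)]) (simp_all add: prog_defs)
  moreover have "fst s' ''t'' = fst s ''t''" "fst s' ''s'' = fst s ''s''"
    by (simp_all add: frame_reg[OF fr] prog_defs)
  ultimately show "runs F (For ''v'' (Reg ''n'') relax_body) s' (n * 74) (\<lambda>s''. snd s'' ''R'' =
      fold (relax1 F n (fst s ''t'') (fst s ''s'') i) [0..<n] (snd s' ''R''))"
    using relax_v_runs[of M s'] assms i by simp
next
  fix s' assume fr: "frame (For ''u'' (Reg ''n'') (For ''v'' (Reg ''n'') relax_body)) s s'"
  have "env M s'" by (rule env_frame[OF fr assms(1)]) (simp_all add: prog_defs)
  then show "expr_val F s' (Reg ''n'') = n" by (simp add: env_def)
qed (rule linear_loop_bound[OF n_pos] | simp add: prog_defs)+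

lemma relax_s_runs:
  assumes "env M s" "fst s ''t'' < T"
  shows "runs F (For ''s'' (Reg ''T'') (For ''u'' (Reg ''n'') (For ''v'' (Reg ''n'') relax_body))) s
     (T * (n * (n * 74 + 14) + 14))
    (\<lambda>s'. snd s' ''R'' = relax_row F n T (fst s ''t'') (snd s ''R''))"
  unfolding relax_row_def
proof (rule runs_For_fold)
  fix i s' assume fr: "frame (For ''s'' (Reg ''T'') (For ''u'' (Reg ''n'') (For ''v'' (Reg ''n'') relax_body))) s s'"
    and i: "fst s' ''s'' = i" "i < T"
  have "env M s'" by (rule env_frame[OF fr assms(1)]) (simp_all add: prog_defs)
  moreover have "fst s' ''t'' = fst s ''t''" by (simp_all add: frame_reg[OF fr] prog_defs)
  ultimately show "runs F (For ''u'' (Reg ''n'') (For ''v'' (Reg ''n'') relax_body)) s' (n * (n * 74 + 14))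
     (\<lambda>s''. snd s'' ''R'' = fold (\<lambda>u. fold (relax1 F n (fst s ''t'') i u) [0..<n]) [0..<n] (snd s' ''R''))"
    using relax_u_runs[of M s'] assms i by simp
next
  fix s' assume fr: "frame (For ''s'' (Reg ''T'') (For ''u'' (Reg ''n'') (For ''v'' (Reg ''n'') relax_body))) s s'"
  have "env M s'" by (rule env_frame[OF fr assms(1)]) (simp_all add: prog_defs)
  then show "expr_val F s' (Reg ''T'') = T" by (simp add: env_def)
qed (rule linear_loop_bound[OF T_pos] | simp add: prog_defs)+

lemma relax_prog_runs:
  assumes "env M s"
  shows "runs F relax_prog s (116 * (T * T * n * n)) (\<lambda>s'. snd s' ''R'' = relax F n T (snd s ''R''))"
proof -
  have "runs F relax_prog s (T * (T * (n * (n * 74 + 14) + 14) + 14))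
    (\<lambda>s'. snd s' ''R'' = relax F n T (snd s ''R''))"
    unfolding relax_def relax_prog_def
  proof (rule runs_For_fold)
    fix i s' assume fr: "frame (For ''t'' (Reg ''T'') (For ''s'' (Reg ''T'') (For ''u'' (Reg ''n'') (For ''v'' (Reg ''n'') relax_body)))) s s'"
      and i: "fst s' ''t'' = i" "i < T"
    have "env M s'" by (rule env_frame[OF fr assms(1)]) (simp_all add: prog_defs)
    then show "runs F (For ''s'' (Reg ''T'') (For ''u'' (Reg ''n'') (For ''v'' (Reg ''n'') relax_body))) s'
       (T * (n * (n * 74 + 14) + 14)) (\<lambda>s''. snd s'' ''R'' = relax_row F n T i (snd s' ''R''))"
      using relax_s_runs[of M s'] i by simp
  next
    fix s' assume fr: "frame (For ''t'' (Reg ''T'') (For ''s'' (Reg ''T'') (For ''u'' (Reg ''n'') (For ''v'' (Reg ''n'') relax_body)))) s s'"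
    have "env M s'" by (rule env_frame[OF fr assms(1)]) (simp_all add: prog_defs)
    then show "expr_val F s' (Reg ''T'') = T" by (simp add: env_def)
  qed (rule linear_loop_bound[OF T_pos] | simp add: prog_defs)+
  \<comment> \<open>The constant is \<open>116 = 74 + 14 + 14 + 14\<close>, all lower-order terms
    being absorbed into the leading one.\<close>
  moreover have "T * (T * (n * (n * 74 + 14) + 14) + 14) \<le> 116 * (T * T * n * n)"
  proof -
    have "T * T * n \<le> T * T * n * n" "T * T \<le> T * T * n" "T \<le> T * T"
      using n_pos T_pos by simp_all
    moreover have "T * (T * (n * (n * 74 + 14) + 14) + 14)
        = 74 * (T * T * n * n) + 14 * (T * T * n) + 14 * (T * T) + 14 * T"
      by (simp add: algebra_simps)
    ultimately show ?thesis by linarith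
  qed
  ultimately show ?thesis by (blast intro: runs_weaken)
qed

lemma clear_prog_runs:
  assumes "env M s" "fst s ''v'' < n"
  shows "runs F clear_prog s (T * 30) (\<lambda>s'. \<forall>t<T. \<forall>w<n. snd s' ''R'' (t * n + w) =
    (if w = fst s ''v'' then 0 else snd s ''R'' (t * n + w)))"
proof -
  define I where "I j s' \<longleftrightarrow> (\<forall>t<T. \<forall>w<n. snd s' ''R'' (t * n + w) =
    (if w = fst s ''v'' \<and> t < j then 0 else snd s ''R'' (t * n + w)))" for j and s' :: state
  have "runs F clear_prog s (T * 30) (I T)"
    unfolding clear_prog_def
  proof (rule runs_For)
    fix j s' assume j: "j < T" "fst s' ''t'' = j" and I: "I j s'"
      and fr: "frame (For ''t'' (Reg ''T'') (Write ''R'' (cell (Reg ''t'') (Reg ''v'')) (Const 0))) s s'"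
    have "env M s'" by (rule env_frame[OF fr assms(1)]) (simp_all add: prog_defs)
    then have "snd s' ''W'' j = j * n" using j by (simp add: env_def)
    moreover have "fst s' ''v'' = fst s ''v''" by (simp add: frame_reg[OF fr])
    ultimately show "runs F (Write ''R'' (cell (Reg ''t'') (Reg ''v'')) (Const 0)) s' 10
        (\<lambda>s''. I (Suc j) ((fst s'')(''t'' := Suc j), snd s''))"
      using I j assms(2) by (auto simp: cell_def I_def cell_eq_iff less_Suc_eq)
  next
    fix s' assume fr: "frame (For ''t'' (Reg ''T'') (Write ''R'' (cell (Reg ''t'') (Reg ''v'')) (Const 0))) s s'"
    have "env M s'" by (rule env_frame[OF fr assms(1)]) (simp_all add: prog_defs)
    then show "expr_val F s' (Reg ''T'') = T" by (simp add: env_def)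
  qed (rule linear_loop_bound[OF T_pos] | simp add: I_def)+
  then show ?thesis by (rule runs_weaken) (simp_all add: I_def)
qed

lemma clear_all_runs:
  assumes "env M s"
  shows "runs F (For ''v'' (Reg ''n'') clear_prog) s (n * (T * 30 + 14))
    (\<lambda>s'. \<forall>t<T. \<forall>w<n. snd s' ''R'' (t * n + w) = 0)"
proof (rule runs_For[where I = "\<lambda>j s'. \<forall>t<T. \<forall>w<j. snd s' ''R'' (t * n + w) = 0"])
  fix j s' assume j: "j < n" "fst s' ''v'' = j" and I: "\<forall>t<T. \<forall>w<j. snd s' ''R'' (t * n + w) = 0"
    and fr: "frame (For ''v'' (Reg ''n'') clear_prog) s s'"
  have "env M s'" by (rule env_frame[OF fr assms(1)]) (simp_all add: prog_defs)
  then show "runs F clear_prog s' (T * 30)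
      (\<lambda>s''. \<forall>t<T. \<forall>w<Suc j. snd ((fst s'')(''v'' := Suc j), snd s'') ''R'' (t * n + w) = 0)"
    by (rule runs_weaken[OF clear_prog_runs]) (use j I in auto)
next
  fix s' assume fr: "frame (For ''v'' (Reg ''n'') clear_prog) s s'"
  have "env M s'" by (rule env_frame[OF fr assms(1)]) (simp_all add: prog_defs)
  then show "expr_val F s' (Reg ''n'') = n" by (simp add: env_def)
qed (rule linear_loop_bound[OF n_pos] | simp add: prog_defs)+

lemma sieve_prog_runs:
  assumes "env M s"
  shows "runs F sieve_prog s (n * (T * 30 + 44))
    (\<lambda>s'. sieved M (snd s ''d'' (Suc (fst s ''i''))) (snd s ''h'') (snd s ''R'') (snd s' ''h'') (snd s' ''R''))"
proof -
  let ?body = "Cond (neq (Read ''h'' (Reg ''v'')) (Read ''d'' (Plus (Reg ''i'') (Const 1))))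
        clear_prog (Write ''h'' (Reg ''v'') (Reg ''M''))"
  define col where "col = snd s ''d'' (Suc (fst s ''i''))"
  define h where "h = snd s ''h''"
  \<comment> \<open>The table part refers to the original \<open>h\<close>, because marking a vertex
    destroys its colour in the current array.\<close>
  define I where "I j s' \<longleftrightarrow> (\<forall>w. snd s' ''h'' w = (if w < j \<and> h w = col then M else h w)) \<and>
    (\<forall>t<T. \<forall>w<n. snd s' ''R'' (t * n + w) =
      (if w < j \<and> h w \<noteq> col then 0 else snd s ''R'' (t * n + w)))" for j and s' :: state
  have "runs F sieve_prog s (n * (T * 30 + 44)) (I n)"
    unfolding sieve_prog_def
  proof (rule runs_For)
    fix j s' assume j: "j < n" "fst s' ''v'' = j" and I: "I j s'"
      and fr: "frame (For ''v'' (Reg ''n'') ?body) s s'"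
    have env: "env M s'" by (rule env_frame[OF fr assms(1)]) (simp_all add: prog_defs)
    have col: "snd s' ''d'' (Suc (fst s' ''i'')) = col"
      by (simp add: frame_reg[OF fr] frame_arr[OF fr] prog_defs col_def)
    have h: "snd s' ''h'' j = h j" using I by (simp add: I_def)
    show "runs F ?body s' (T * 30 + 30) (\<lambda>s''. I (Suc j) ((fst s'')(''v'' := Suc j), snd s''))"
    proof (cases "h j = col")
      case True
      then show ?thesis using I j h col env by (auto simp: I_def env_def less_Suc_eq)
    next
      case False
      have "runs F clear_prog s' (T * 30 + 10) (\<lambda>s''. I (Suc j) ((fst s'')(''v'' := Suc j), snd s''))"
      proof (rule runs_weaken[OF clear_prog_runs[OF env]])
        fix s'' assume "frame clear_prog s' s''" and
          R: "\<forall>t<T. \<forall>w<n. snd s'' ''R'' (t * n + w) = (if w = fst s' ''v'' then 0 else snd s' ''R'' (t * n + w))"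
        then have "snd s'' ''h'' = snd s' ''h''" using frame_arr by (fastforce simp: prog_defs)
        then show "I (Suc j) ((fst s'')(''v'' := Suc j), snd s'')"
          using I R j False by (auto simp: I_def less_Suc_eq)
      qed (use j in auto)
      then show ?thesis using False h col j by (auto intro: runs_weaken)
    qed
  next
    fix s' assume fr: "frame (For ''v'' (Reg ''n'') ?body) s s'"
    have "env M s'" by (rule env_frame[OF fr assms(1)]) (simp_all add: prog_defs)
    then show "expr_val F s' (Reg ''n'') = n" by (simp add: env_def)
  qed (rule linear_loop_bound[OF n_pos] | simp add: prog_defs I_def h_def)+
  then show ?thesis by (rule runs_weaken) (simp_all add: I_def sieved_def col_def h_def)
qed

lemma hash_prog_runs:
  assumes "env M s"
  shows "runs F hash_prog s (n * 60) (\<lambda>s'. \<forall>v<n. snd s' ''h'' v = v mod snd s ''d'' 0)"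
  unfolding hash_prog_def runs_Seq_Assign
proof (intro conjI)
  let ?body = "Seq (Write ''h'' (Reg ''v'') (Reg ''r''))
       (Seq (Assign ''r'' (Plus (Reg ''r'') (Const 1)))
         (Cond (neq (Reg ''r'') (Read ''d'' (Const 0))) Skip (Assign ''r'' (Const 0))))"
  let ?s = "((fst s)(''r'' := expr_val F s (Const 0)), snd s)"
  define m where "m = snd s ''d'' 0"
  define I where "I j s' \<longleftrightarrow> fst s' ''r'' = j mod m \<and> (\<forall>v<j. snd s' ''h'' v = v mod m)" for j and s' :: state
  have env: "env M ?s" using assms by simp
  have "runs F (For ''v'' (Reg ''n'') ?body) ?s (n * 60 - 2) (I n)"
  proof (rule runs_For)
    fix j s' assume j: "j < n" "fst s' ''v'' = j" and I: "I j s'"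
      and fr: "frame (For ''v'' (Reg ''n'') ?body) ?s s'"
    have "snd s' ''d'' 0 = m" by (simp add: frame_arr[OF fr] m_def)
    then show "runs F ?body s' 40 (\<lambda>s''. I (Suc j) ((fst s'')(''v'' := Suc j), snd s''))"
      using I j by (auto simp: I_def less_Suc_eq mod_Suc)
  next
    fix s' assume fr: "frame (For ''v'' (Reg ''n'') ?body) ?s s'"
    have "env M s'" by (rule env_frame[OF fr env]) (simp_all add: prog_defs)
    then show "expr_val F s' (Reg ''n'') = n" by (simp add: env_def)
  qed (use n_pos in \<open>simp_all add: prog_defs I_def\<close>)
  then show "runs F (For ''v'' (Reg ''n'') ?body) ?s (n * 60 - (1 + expr_time (Const 0)))
     (\<lambda>s'. \<forall>v<n. snd s' ''h'' v = v mod snd s ''d'' 0)"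
    by (rule runs_weaken) (simp_all add: I_def m_def)
qed (use n_pos in simp)

text \<open>The counter fixes only the digits \<open>0\<close> to \<open>k\<close>, whereas the
  array and an abstract guess may differ beyond them.\<close>

lemma dp_cong:
  assumes "\<And>i. i \<le> k \<Longrightarrow> d i = d' i" "dp d M k h R"
  shows "dp d' M k h R"
proof -
  have "d ` {1..k} = d' ` {1..k}" using assms(1) by (intro image_cong) auto
  moreover have "inj_on d {1..k} \<longleftrightarrow> inj_on d' {1..k}" using assms(1) by (intro inj_on_cong) auto
  ultimately show ?thesis using assms by (simp add: dp_def hash_def complete_table_def)
qed

text \<open>Since \<open>k\<close> may be 0, the budget keeps the loop overhead 6 as a separate
  summand.\<close>

lemma rounds_runs:
  assumes env: "env M s" and d: "\<And>i. i \<le> k \<Longrightarrow> snd s ''d'' i < M"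
    and dp: "dp (snd s ''d'') M 0 (snd s ''h'') (snd s ''R'')"
  shows "runs F (For ''i'' (Reg ''k'') (Seq sieve_prog relax_prog)) s
    (k * (n * (T * 30 + 44) + 116 * (T * T * n * n) + 8) + 6)
    (\<lambda>s'. dp (snd s ''d'') M k (snd s' ''h'') (snd s' ''R''))"
proof (rule runs_For[where I = "\<lambda>i s'. dp (snd s ''d'') M i (snd s' ''h'') (snd s' ''R'')"])
  fix i s' assume i: "i < k" "fst s' ''i'' = i" and dp: "dp (snd s ''d'') M i (snd s' ''h'') (snd s' ''R'')"
    and fr: "frame (For ''i'' (Reg ''k'') (Seq sieve_prog relax_prog)) s s'"
  have env': "env M s'" by (rule env_frame[OF fr env]) (simp_all add: prog_defs)
  have d': "snd s' ''d'' = snd s ''d''" by (rule frame_arr[OF fr]) (simp add: prog_defs)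
  show "runs F (Seq sieve_prog relax_prog) s' (n * (T * 30 + 44) + 116 * (T * T * n * n))
      (\<lambda>s''. dp (snd s ''d'') M (Suc i) (snd ((fst s'')(''i'' := Suc i), snd s'') ''h'')
         (snd ((fst s'')(''i'' := Suc i), snd s'') ''R''))"
  proof (rule runs_Seq[OF sieve_prog_runs[OF env']])
    fix s1 assume fr1: "frame sieve_prog s' s1" and
      sieved: "sieved M (snd s' ''d'' (Suc (fst s' ''i''))) (snd s' ''h'') (snd s' ''R'') (snd s1 ''h'') (snd s1 ''R'')"
    have env1: "env M s1" by (rule env_frame[OF fr1 env']) (simp_all add: prog_defs)
    have "dp (snd s ''d'') M (Suc i) (snd s1 ''h'') (relax F n T (snd s1 ''R''))"
      using sieved i d by (intro dp_round[OF dp]) (auto simp: d')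
    moreover have "snd s2 ''h'' = snd s1 ''h''" if "frame relax_prog s1 s2" for s2
      by (rule frame_arr[OF that]) (simp add: prog_defs)
    ultimately show "runs F relax_prog s1 (116 * (T * T * n * n))
      (\<lambda>s''. dp (snd s ''d'') M (Suc i) (snd ((fst s'')(''i'' := Suc i), snd s'') ''h'')
         (snd ((fst s'')(''i'' := Suc i), snd s'') ''R''))"
      by (intro runs_weaken[OF relax_prog_runs[OF env1]]) auto
  qed simp
next
  fix s' assume fr: "frame (For ''i'' (Reg ''k'') (Seq sieve_prog relax_prog)) s s'"
  have "env M s'" by (rule env_frame[OF fr env]) (simp_all add: prog_defs)
  then show "expr_val F s' (Reg ''k'') = k" by (simp add: env_def)
qed (use dp in \<open>simp_all add: prog_defs\<close>)

text \<open>The final tables are hidden by quantifiers, as both acceptance lemmas hold for any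
  tables satisfying \<open>dp\<close>. The answer is never reset, so it accumulates the disjunction
  over all guesses.\<close>

lemma trial_prog_runs:
  assumes env: "env M s" and d: "\<And>i. i \<le> k \<Longrightarrow> snd s ''d'' i < M"
  shows "runs F trial_prog s (Suc k * (500 * (T * T * n * n)))
    (\<lambda>s'. \<exists>h R. dp (snd s ''d'') M k h R \<and>
       fst s' ''answer'' = (if 0 < R ((T - 1) * n + vt) then 1 else fst s ''answer''))"
proof -
  let ?X = "T * T * n * n"
  let ?Q = "\<lambda>s'. \<exists>h R. dp (snd s ''d'') M k h R \<and>
       fst s' ''answer'' = (if 0 < R ((T - 1) * n + vt) then 1 else fst s ''answer'')"
  let ?rounds = "For ''i'' (Reg ''k'') (Seq sieve_prog relax_prog)"
  let ?decide = "Cond (Read ''R'' (cell (Minus (Reg ''T'') (Const 1)) (Reg ''sink'')))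
            (Assign ''answer'' (Const 1)) Skip"
  let ?B5 = "k * (n * (T * 30 + 44) + 116 * ?X + 8) + 6"
  have "runs F trial_prog s (n * 60 + (n * (T * 30 + 14) + (5 + (116 * ?X + (?B5 + 20))))) ?Q"
    unfolding trial_prog_def
  proof (rule runs_Seq[OF hash_prog_runs[OF env]])
    fix s1 assume fr1: "frame hash_prog s s1" and h1: "\<forall>v<n. snd s1 ''h'' v = v mod snd s ''d'' 0"
    have env1: "env M s1" by (rule env_frame[OF fr1 env]) (simp_all add: prog_defs)
    have d1: "snd s1 ''d'' = snd s ''d''" by (rule frame_arr[OF fr1]) (simp add: prog_defs)
    have a1: "fst s1 ''answer'' = fst s ''answer''" by (rule frame_reg[OF fr1]) (simp add: prog_defs)
    show "runs F (Seq (For ''v'' (Reg ''n'') clear_prog)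
        (Seq (Write ''R'' (Reg ''source'') (Plus (Reg ''budget'') (Const 1)))
          (Seq relax_prog (Seq ?rounds ?decide)))) s1
        (n * (T * 30 + 14) + (5 + (116 * ?X + (?B5 + 20)))) ?Q"
    proof (rule runs_Seq[OF clear_all_runs[OF env1]])
      fix s2 assume fr2: "frame (For ''v'' (Reg ''n'') clear_prog) s1 s2"
        and R2: "\<forall>t<T. \<forall>w<n. snd s2 ''R'' (t * n + w) = 0"
      have env2: "env M s2" by (rule env_frame[OF fr2 env1]) (simp_all add: prog_defs)
      have h2: "snd s2 ''h'' = snd s1 ''h''" by (rule frame_arr[OF fr2]) (simp add: prog_defs)
      have d2: "snd s2 ''d'' = snd s ''d''" using frame_arr[OF fr2, of "''d''"] by (simp add: prog_defs d1)
      have a2: "fst s2 ''answer'' = fst s ''answer''"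
        using frame_reg[OF fr2, of "''answer''"] by (simp add: prog_defs a1)
      \<comment> \<open>Index \<open>vs\<close> is the cell \<open>0 * n + vs\<close> of the source
        at time 1; \<open>Suc f\<close> encodes the full budget.\<close>
      define s3 where "s3 = (fst s2, (snd s2)(''R'' := (snd s2 ''R'')(vs := Suc f)))"
      have env3: "env M s3" using env2 by (simp add: env_def s3_def)
      have R3: "snd s3 ''R'' (t * n + v) = (if t = 0 \<and> v = vs then Suc f else 0)" if "t < T" "v < n" for t v
        using that R2 source cell_eq_iff[of v n vs t 0] by (auto simp: s3_def)
      have loop: "runs F (Seq relax_prog (Seq ?rounds ?decide)) s3 (116 * ?X + (?B5 + 20)) ?Q"
      proof (rule runs_Seq[OF relax_prog_runs[OF env3]])
        fix s4 assume fr4: "frame relax_prog s3 s4" and R4: "snd s4 ''R'' = relax F n T (snd s3 ''R'')"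
        have env4: "env M s4" by (rule env_frame[OF fr4 env3]) (simp_all add: prog_defs)
        have h4: "snd s4 ''h'' = snd s1 ''h''" using frame_arr[OF fr4, of "''h''"] by (simp add: prog_defs h2 s3_def)
        have d4: "snd s4 ''d'' = snd s ''d''" using frame_arr[OF fr4, of "''d''"] by (simp add: prog_defs d2 s3_def)
        have a4: "fst s4 ''answer'' = fst s ''answer''"
          using frame_reg[OF fr4, of "''answer''"] by (simp add: prog_defs a2 s3_def)
        have dp4: "dp (snd s4 ''d'') M 0 (snd s4 ''h'') (snd s4 ''R'')"
          unfolding R4 h4 d4 using h1 R3 by (intro dp_start) auto
        show "runs F (Seq ?rounds ?decide) s4 (?B5 + 20) ?Q"
        proof (rule runs_Seq[OF rounds_runs[OF env4 _ dp4]])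
          fix s5 assume fr5: "frame ?rounds s4 s5" and dp5: "dp (snd s4 ''d'') M k (snd s5 ''h'') (snd s5 ''R'')"
          define e where "e = Read ''R'' (cell (Minus (Reg ''T'') (Const 1)) (Reg ''sink''))"
          have "env M s5" by (rule env_frame[OF fr5 env4]) (simp_all add: prog_defs)
          then have "expr_val F s5 e = snd s5 ''R'' ((T - 1) * n + vt)"
            using T_pos by (simp add: e_def cell_def env_def)
          moreover have "expr_time e = 7" by (simp add: e_def cell_def)
          moreover have "fst s5 ''answer'' = fst s ''answer''"
            using frame_reg[OF fr5, of "''answer''"] by (simp add: prog_defs a4)
          ultimately have "runs F ?decide s5 20 (\<lambda>s'. dp (snd s ''d'') M k (snd s5 ''h'') (snd s5 ''R'') \<and>
              fst s' ''answer'' = (if 0 < snd s5 ''R'' ((T - 1) * n + vt) then 1 else fst s ''answer''))"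
            using dp5 unfolding d4 e_def[symmetric] by simp
          then show "runs F ?decide s5 20 ?Q" by (rule runs_weaken) blast+
        qed (use d d4 in auto)
      qed simp
      show "runs F (Seq (Write ''R'' (Reg ''source'') (Plus (Reg ''budget'') (Const 1)))
          (Seq relax_prog (Seq ?rounds ?decide))) s2 (5 + (116 * ?X + (?B5 + 20))) ?Q"
      proof (rule runs_Seq)
        have "fst s2 ''source'' = vs" "fst s2 ''budget'' = f" using env2 by (simp_all add: env_def)
        then show "runs F (Write ''R'' (Reg ''source'') (Plus (Reg ''budget'') (Const 1))) s2 5 (\<lambda>s'. s' = s3)"
          by (simp add: s3_def)
      qed (use loop in auto)
    qed simp
  qed simp
  moreover have "n * 60 + (n * (T * 30 + 14) + (5 + (116 * ?X + (?B5 + 20)))) \<le> Suc k * (500 * ?X)"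
  proof -
    have le: "n * T \<le> ?X" "n \<le> n * T" "1 \<le> n" using n_pos T_pos by (simp_all add: mult_ac)
    have eq: "n * (T * 30 + 44) = 30 * (n * T) + 44 * n" "n * (T * 30 + 14) = 30 * (n * T) + 14 * n"
      by (simp_all add: algebra_simps)
    have "n * (T * 30 + 44) + 116 * ?X + 8 \<le> 200 * ?X"
      unfolding eq using le by linarith
    then have "k * (n * (T * 30 + 44) + 116 * ?X + 8) \<le> k * (200 * ?X)" by (rule mult_le_mono2)
    moreover have "n * (T * 30 + 14) \<le> 44 * ?X" unfolding eq using le by linarith
    moreover have "Suc k * (500 * ?X) = 500 * ?X + 300 * (k * ?X) + k * (200 * ?X)" by simp
    ultimately show ?thesis using le by linarith
  qed
  ultimately show ?thesis by (blast intro: runs_weaken)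
qed

lemma increment_prog_runs:
  assumes env: "env M s" and M: "2 \<le> M" and d: "\<And>i. i \<le> k \<Longrightarrow> snd s ''d'' i = N div M ^ i mod M"
  shows "runs F increment_prog s (Suc k * 60) (\<lambda>s'. (\<forall>i\<le>k. snd s' ''d'' i = Suc N div M ^ i mod M) \<and>
    fst s' ''c'' + N div M ^ Suc k = Suc N div M ^ Suc k)"
  unfolding increment_prog_def runs_Seq_Assign
proof (intro conjI)
  let ?body = "Seq (Write ''d'' (Reg ''i'') (Plus (Read ''d'' (Reg ''i'')) (Reg ''c'')))
        (Cond (neq (Read ''d'' (Reg ''i'')) (Reg ''M''))
           (Assign ''c'' (Const 0))
           (Write ''d'' (Reg ''i'') (Const 0)))"
  let ?e = "Plus (Reg ''k'') (Const 1)"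
  let ?s = "((fst s)(''c'' := expr_val F s (Const 1)), snd s)"
  \<comment> \<open>Digits below position \<open>j\<close> already belong to \<open>Suc N\<close>,
    the others still to \<open>N\<close>; register \<open>c\<close> is the carry into position
    \<open>j\<close>.\<close>
  define I where "I j s' \<longleftrightarrow> (\<forall>i\<le>k. snd s' ''d'' i = (if i < j then Suc N else N) div M ^ i mod M) \<and>
    fst s' ''c'' \<le> 1 \<and> N div M ^ j + fst s' ''c'' = Suc N div M ^ j" for j and s' :: state
  have env': "env M ?s" using env by simp
  have "runs F (For ''i'' ?e ?body) ?s (Suc k * 60 - 2) (I (Suc k))"
  proof (rule runs_For)
    fix j s' assume j: "j < Suc k" "fst s' ''i'' = j" and I: "I j s'"
      and fr: "frame (For ''i'' ?e ?body) ?s s'"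
    have "env M s'" by (rule env_frame[OF fr env']) simp_all
    then have M': "fst s' ''M'' = M" by (simp add: env_def)
    have dj: "snd s' ''d'' j = N div M ^ j mod M" using I j by (simp add: I_def)
    have c: "fst s' ''c'' \<le> 1" "N div M ^ j + fst s' ''c'' = Suc N div M ^ j" using I by (auto simp: I_def)
    have step: "x div M ^ Suc j = x div M ^ j div M" for x
      by (simp only: power_Suc2 div_mult2_eq)
    show "runs F ?body s' 30 (\<lambda>s''. I (Suc j) ((fst s'')(''i'' := Suc j), snd s''))"
    proof (cases "N div M ^ j mod M + fst s' ''c'' = M")
      case True
      have "fst s' ''c'' = 1" using True c(1) M mod_less_divisor[of M "N div M ^ j"] by linarith
      moreover note carry(1)[OF M c(1) True, unfolded c(2)]
      ultimately show ?thesis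
        using I j True M' dj by (auto simp: I_def step less_Suc_eq simp del: power_Suc)
    next
      case False
      note carry(2)[OF M c(1) False, unfolded c(2)]
      then show ?thesis
        using I j False M' dj by (auto simp: I_def step less_Suc_eq simp del: power_Suc)
    qed
  next
    fix s' assume fr: "frame (For ''i'' ?e ?body) ?s s'"
    have "env M s'" by (rule env_frame[OF fr env']) simp_all
    then show "expr_val F s' ?e = Suc k" by (simp add: env_def)
  qed (use d in \<open>simp_all add: I_def\<close>)
  then show "runs F (For ''i'' ?e ?body) ?s (Suc k * 60 - (1 + expr_time (Const 1)))
    (\<lambda>s'. (\<forall>i\<le>k. snd s' ''d'' i = Suc N div M ^ i mod M) \<and>
      fst s' ''c'' + N div M ^ Suc k = Suc N div M ^ Suc k)"
    by (rule runs_weaken) (simp_all add: I_def add.commute)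
qed simp

lemma log_prog_runs:
  assumes "fst s ''n'' = n" "fst s ''L'' = 0"
  shows "runs F log_prog s (n * 30) (\<lambda>s'. n \<le> 2 ^ fst s' ''L'' \<and> 2 ^ fst s' ''L'' \<le> 2 * n)"
  unfolding log_prog_def runs_Seq_Assign
proof (intro conjI)
  \<comment> \<open>Minimality gives \<open>2 ^ (L - 1) < n\<close>, hence
    \<open>2 ^ L <= 2 * n\<close>. The crude bound \<open>L <= n\<close> suffices for the time of
    this loop.\<close>
  define L where "L = (LEAST i. n \<le> 2 ^ i)"
  have ex: "n \<le> 2 ^ n" by (simp add: less_imp_le)
  have L: "n \<le> 2 ^ L" unfolding L_def using ex by (rule LeastI)
  have below: "2 ^ i < n" if "i < L" for i
    using not_less_Least[OF that[unfolded L_def]] by simp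
  have "L \<le> n" unfolding L_def using ex by (rule Least_le)
  have upper: "2 ^ L \<le> 2 * n"
    using below[of "L - 1"] n_pos by (cases L) auto
  define I where "I i s' \<longleftrightarrow> fst s' ''n'' = n \<and> fst s' ''p'' = 2 ^ i \<and> fst s' ''L'' = i" for i and s' :: state
  let ?s = "((fst s)(''p'' := expr_val F s (Const 1)), snd s)"
  have "runs F (Loop (Minus (Reg ''n'') (Reg ''p''))
     (Seq (Assign ''p'' (Plus (Reg ''p'') (Reg ''p''))) (Assign ''L'' (Plus (Reg ''L'') (Const 1)))))
     ?s (n * 30 - 2) (I L)"
  proof (rule runs_Loop[where i = 0 and B = 8])
    show "(expr_val F s' (Minus (Reg ''n'') (Reg ''p'')) = 0) = (i = L)" if "i \<le> L" "I i s'" for i s'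
      using that L below[of i] by (cases "i < L") (auto simp: I_def)
  qed (use assms n_pos \<open>L \<le> n\<close> in \<open>simp_all add: I_def\<close>)
  then show "runs F (Loop (Minus (Reg ''n'') (Reg ''p''))
     (Seq (Assign ''p'' (Plus (Reg ''p'') (Reg ''p''))) (Assign ''L'' (Plus (Reg ''L'') (Const 1)))))
     ?s (n * 30 - (1 + expr_time (Const 1))) (\<lambda>s'. n \<le> 2 ^ fst s' ''L'' \<and> 2 ^ fst s' ''L'' \<le> 2 * n)"
    by (rule runs_weaken) (use L upper in \<open>simp_all add: I_def\<close>)
qed (use n_pos in simp)

lemma modulus_prog_runs:
  assumes "fst s ''k'' = k"
  shows "runs F modulus_prog s (Suc k * Suc k * 20) (\<lambda>s'. fst s' ''M'' = 3 + k * k * fst s ''L'')"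
  unfolding modulus_prog_def runs_Seq_Assign
proof (intro conjI)
  let ?body = "Assign ''M'' (Plus (Reg ''M'') (Reg ''L''))"
  let ?s = "((fst s)(''M'' := expr_val F s (Const 3)), snd s)"
  have "runs F (For ''i'' (Reg ''k'') (For ''j'' (Reg ''k'') ?body)) ?s (Suc k * Suc k * 20 - 2)
      (\<lambda>s'. fst s' ''M'' = 3 + k * k * fst s ''L'')"
  proof (rule runs_For[where I = "\<lambda>i s'. fst s' ''M'' = 3 + i * k * fst s ''L''" and N = k])
    fix i s' assume M: "fst s' ''M'' = 3 + i * k * fst s ''L''"
      and fr: "frame (For ''i'' (Reg ''k'') (For ''j'' (Reg ''k'') ?body)) ?s s'"
    have k: "fst s' ''k'' = k" and L: "fst s' ''L'' = fst s ''L''" using assms by (simp_all add: frame_reg[OF fr])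
    have "runs F (For ''j'' (Reg ''k'') ?body) s' (k * 12 + 6)
        (\<lambda>s''. fst s'' ''M'' = 3 + i * k * fst s ''L'' + k * fst s ''L'')"
    proof (rule runs_For[where I = "\<lambda>j s''. fst s'' ''M'' = 3 + i * k * fst s ''L'' + j * fst s ''L''" and N = k])
      fix j s'' assume M: "fst s'' ''M'' = 3 + i * k * fst s ''L'' + j * fst s ''L''"
        and fr': "frame (For ''j'' (Reg ''k'') ?body) s' s''"
      have "fst s'' ''L'' = fst s ''L''" by (simp add: frame_reg[OF fr'] L)
      then show "runs F ?body s'' 4 (\<lambda>s'''. fst ((fst s''')(''j'' := Suc j), snd s''') ''M'' =
          3 + i * k * fst s ''L'' + Suc j * fst s ''L'')"
        using M by simp
    qed (use M k in \<open>simp_all add: frame_reg\<close>)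
    then show "runs F (For ''j'' (Reg ''k'') ?body) s' (k * 12 + 6) (\<lambda>s''.
        fst ((fst s'')(''i'' := Suc i), snd s'') ''M'' = 3 + Suc i * k * fst s ''L'')"
      by (rule runs_weaken) (simp_all add: algebra_simps)
  qed (use assms in \<open>simp_all add: frame_reg algebra_simps\<close>)
  then show "runs F (For ''i'' (Reg ''k'') (For ''j'' (Reg ''k'') ?body)) ?s
      (Suc k * Suc k * 20 - (1 + expr_time (Const 3))) (\<lambda>s'. fst s' ''M'' = 3 + k * k * fst s ''L'')"
    by simp
qed simp

lemma offset_prog_runs:
  assumes "fst s ''n'' = n" "fst s ''T'' = T" "snd s ''W'' 0 = 0"
  shows "runs F offset_prog s (T * 30) (\<lambda>s'. \<forall>t<T. snd s' ''W'' t = t * n)"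
proof -
  let ?body = "Write ''W'' (Plus (Reg ''t'') (Const 1)) (Plus (Read ''W'' (Reg ''t'')) (Reg ''n''))"
  \<comment> \<open>Strengthened to \<open>t <= T\<close>, since each iteration writes one entry
    ahead.\<close>
  have "runs F offset_prog s (T * 30) (\<lambda>s'. \<forall>t\<le>T. snd s' ''W'' t = t * n)"
    unfolding offset_prog_def
  proof (rule runs_For[where I = "\<lambda>j s'. \<forall>t\<le>j. snd s' ''W'' t = t * n"])
    fix j s' assume "fst s' ''t'' = j" "\<forall>t\<le>j. snd s' ''W'' t = t * n"
      and fr: "frame (For ''t'' (Reg ''T'') ?body) s s'"
    moreover have "fst s' ''n'' = n" using assms by (simp add: frame_reg[OF fr])
    ultimately show "runs F ?body s' 10
        (\<lambda>s''. \<forall>t\<le>Suc j. snd ((fst s'')(''t'' := Suc j), snd s'') ''W'' t = t * n)"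
      by (auto simp: le_Suc_eq)
  next
    fix s' assume fr: "frame (For ''t'' (Reg ''T'') ?body) s s'"
    show "expr_val F s' (Reg ''T'') = T" using assms by (simp add: frame_reg[OF fr])
  qed (use assms T_pos in simp_all)
  then show ?thesis by (rule runs_weaken) simp_all
qed

lemma main_loop_runs:
  fixes L :: nat
  defines "M \<equiv> 3 + k * k * L"
  assumes env: "env M s" and "\<And>i. snd s ''d'' i = 0" "fst s ''c'' = 0" "fst s ''answer'' = 0"
    and L: "n \<le> 2 ^ L"
  shows "runs F (Loop (Minus (Const 1) (Reg ''c'')) (Seq trial_prog increment_prog)) s
    (M ^ Suc k * (Suc k * (570 * (T * T * n * n))))
    (\<lambda>s'. accepting s' \<longleftrightarrow> temporal_orienteering {..<n} T F vs vt k f)"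
proof -
  let ?X = "T * T * n * n"
  let ?yes = "temporal_orienteering {..<n} T F vs vt k f"
  have M: "2 \<le> M" by (simp add: M_def)
  define digits where "digits N d \<longleftrightarrow> (\<forall>i\<le>k. d i = N div M ^ i mod M)" for N and d :: "nat \<Rightarrow> nat"
  define accepts where "accepts d \<longleftrightarrow> (\<forall>h R. dp d M k h R \<longrightarrow> 0 < R ((T - 1) * n + vt))" for d
  \<comment> \<open>\<open>N\<close> is the number of guesses already tried. A nonzero answer must
    be justified by a solution, and conversely an accepting guess among those tried must have set
    it.\<close>
  define I where "I N s' \<longleftrightarrow> env M s' \<and> digits N (snd s' ''d'') \<and>
    fst s' ''c'' = (if N = M ^ Suc k then 1 else 0) \<and> (fst s' ''answer'' \<noteq> 0 \<longrightarrow> ?yes) \<and>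
    (\<forall>N'<N. \<forall>d. digits N' d \<longrightarrow> accepts d \<longrightarrow> fst s' ''answer'' \<noteq> 0)" for N and s' :: state
  have pos: "0 < M ^ Suc k" using M by simp
  have X: "1 \<le> ?X" using n_pos T_pos by (simp add: Suc_le_eq)
  have "runs F (Loop (Minus (Const 1) (Reg ''c'')) (Seq trial_prog increment_prog)) s
    (M ^ Suc k * (Suc k * (570 * ?X))) (I (M ^ Suc k))"
  proof (rule runs_Loop[where i = 0])
    show "I 0 s" using assms pos by (auto simp: I_def digits_def simp del: power_Suc)
    show "(expr_val F s' (Minus (Const 1) (Reg ''c'')) = 0) = (N = M ^ Suc k)" if "I N s'" for N s'
      using that by (simp add: I_def del: power_Suc)
    fix N s' assume N: "N < M ^ Suc k" and I: "I N s'"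
    let ?ans = "fst s' ''answer''"
    have env': "env M s'" and d: "digits N (snd s' ''d'')" using I by (auto simp: I_def)
    show "runs F (Seq trial_prog increment_prog) s' (Suc k * (500 * ?X) + Suc k * 60) (I (Suc N))"
    proof (rule runs_Seq[OF trial_prog_runs[OF env']])
      show "snd s' ''d'' i < M" if "i \<le> k" for i using d that M by (simp add: digits_def)
      fix s1 assume fr1: "frame trial_prog s' s1" and "\<exists>h R. dp (snd s' ''d'') M k h R \<and>
         fst s1 ''answer'' = (if 0 < R ((T - 1) * n + vt) then 1 else ?ans)"
      then obtain h R where dp: "dp (snd s' ''d'') M k h R"
        and ans: "fst s1 ''answer'' = (if 0 < R ((T - 1) * n + vt) then 1 else ?ans)" by blast
      have env1: "env M s1" by (rule env_frame[OF fr1 env']) (simp_all add: prog_defs)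
      have d1: "snd s1 ''d'' = snd s' ''d''" by (rule frame_arr[OF fr1]) (simp add: prog_defs)
      show "runs F increment_prog s1 (Suc k * 60) (I (Suc N))"
      proof (rule runs_weaken[OF increment_prog_runs[OF env1 M, of N]])
        show "snd s1 ''d'' i = N div M ^ i mod M" if "i \<le> k" for i
          using d that by (simp add: d1 digits_def)
        fix s2 assume fr2: "frame increment_prog s1 s2"
          and "(\<forall>i\<le>k. snd s2 ''d'' i = Suc N div M ^ i mod M) \<and>
            fst s2 ''c'' + N div M ^ Suc k = Suc N div M ^ Suc k"
        \<comment> \<open>As \<open>N < M ^ Suc k\<close>, the quotient
          \<open>N div M ^ Suc k\<close> is 0, so the final carry is 1 exactly when the counter
          overflows.\<close>
        then have d2: "digits (Suc N) (snd s2 ''d'')" and c: "fst s2 ''c'' = Suc N div M ^ Suc k"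
          using N by (auto simp: digits_def simp del: power_Suc)
        have a2: "fst s2 ''answer'' = fst s1 ''answer''"
          by (rule frame_reg[OF fr2]) (simp add: prog_defs)
        have "env M s2" by (rule env_frame[OF fr2 env1]) (simp_all add: prog_defs)
        moreover have "fst s2 ''c'' = (if Suc N = M ^ Suc k then 1 else 0)"
          using N pos c by (auto simp: le_less_Suc_eq simp del: power_Suc)
        moreover have "fst s2 ''answer'' \<noteq> 0 \<longrightarrow> ?yes"
          using I dp_accept_sound[OF dp] by (auto simp: I_def a2 ans)
        moreover have "fst s2 ''answer'' \<noteq> 0" if "N' < Suc N" "digits N' d" "accepts d" for N' d
        proof (cases "N' = N")
          case True
          have "dp d M k h R" by (rule dp_cong[OF _ dp]) (use True \<open>digits N' d\<close> \<open>digits N (snd s' ''d'')\<close> in \<open>simp add: digits_def\<close>)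
          then show ?thesis using that by (auto simp: accepts_def a2 ans)
        next
          case False
          then have "N' < N" using that by simp
          then have "?ans \<noteq> 0" using that I unfolding I_def by blast
          then show ?thesis by (simp add: a2 ans)
        qed
        ultimately show "I (Suc N) s2" using d2 by (auto simp: I_def)
      qed simp
    qed simp
  next
    \<comment> \<open>\<open>570 = 500 + 60 + 10\<close>: trial, increment, and 10 steps per
      iteration that cover its loop test and the final failing one.\<close>
    let ?b = "Suc k * (500 * ?X) + Suc k * 60"
    have "?b + 10 \<le> Suc k * (570 * ?X)"
    proof -
      have "Suc k * (570 * ?X) = Suc k * (500 * ?X) + Suc k * (60 * ?X) + Suc k * (10 * ?X)" by simp
      moreover have "Suc k * (60 * 1) \<le> Suc k * (60 * ?X)" "Suc 0 * (10 * 1) \<le> Suc k * (10 * ?X)"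
        using X by (intro mult_le_mono; simp)+
      ultimately show ?thesis by linarith
    qed
    then have "M ^ Suc k * (?b + 10) \<le> M ^ Suc k * (Suc k * (570 * ?X))" by (rule mult_le_mono2)
    moreover have "M ^ Suc k * (?b + 10) = M ^ Suc k * (?b + 3 + 1) + M ^ Suc k * 6"
      by (simp only: distrib_left[symmetric]) simp
    moreover have "1 \<le> M ^ Suc k" using pos by linarith
    ultimately have *: "M ^ Suc k * (?b + 3 + 1) + 3 + 1 \<le> M ^ Suc k * (Suc k * (570 * ?X))" by linarith
    have e: "expr_time (Minus (Const 1) (Reg ''c'')) = 3" by simp
    show "(M ^ Suc k - 0) * (?b + expr_time (Minus (Const 1) (Reg ''c'')) + 1) +
       expr_time (Minus (Const 1) (Reg ''c'')) + 1 \<le> M ^ Suc k * (Suc k * (570 * ?X))"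
      unfolding e diff_zero by (rule *)
  qed simp
  then show ?thesis
  proof (rule runs_weaken)
    fix s' assume I: "I (M ^ Suc k) s'"
    have "fst s' ''answer'' \<noteq> 0" if yes: ?yes
    proof -
      obtain d where d: "\<forall>i\<le>k. d i < M" "accepts d"
        using dp_accept_complete[OF yes L] by (auto simp: M_def accepts_def)
      then obtain N where "N < M ^ Suc k" "digits N d"
        using exists_digits[of "Suc k" d M] by (auto simp: digits_def less_Suc_eq_le simp del: power_Suc)
      then show ?thesis using I d by (auto simp: I_def simp del: power_Suc)
    qed
    then show "accepting s' \<longleftrightarrow> ?yes" using I by (auto simp: I_def accepting_def)
  qed simp
qed

lemma orienteering_prog_runs:
  "runs F orienteering_prog (input_state n T vs vt k f)
     (25000 * 3 ^ k * Suc k ^ (3 * Suc k + 2) * T ^ 2 * n ^ 4)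
     (\<lambda>s. accepting s \<longleftrightarrow> temporal_orienteering {..<n} T F vs vt k f)"
proof -
  let ?X = "T * T * n * n"
  let ?loop = "Loop (Minus (Const 1) (Reg ''c'')) (Seq trial_prog increment_prog)"
  let ?Q = "\<lambda>s. accepting s \<longleftrightarrow> temporal_orienteering {..<n} T F vs vt k f"
  let ?s = "input_state n T vs vt k f"
  let ?K = "36 * 3 ^ k * Suc k ^ (3 * Suc k) * n\<^sup>2"
  let ?B = "?K * (Suc k * (570 * ?X))"
  have "runs F orienteering_prog ?s (n * 30 + (Suc k * Suc k * 20 + (T * 30 + ?B))) ?Q"
    unfolding orienteering_prog_def
  proof (rule runs_Seq[OF log_prog_runs])
    fix s1 assume fr1: "frame log_prog ?s s1"
      and L: "n \<le> 2 ^ fst s1 ''L'' \<and> 2 ^ fst s1 ''L'' \<le> 2 * n"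
    define L where "L = fst s1 ''L''"
    show "runs F (Seq modulus_prog (Seq offset_prog ?loop)) s1 (Suc k * Suc k * 20 + (T * 30 + ?B)) ?Q"
    proof (rule runs_Seq[OF modulus_prog_runs])
      show "fst s1 ''k'' = k" by (simp add: frame_reg[OF fr1] prog_defs input_state_def)
      fix s2 assume fr2: "frame modulus_prog s1 s2" and M: "fst s2 ''M'' = 3 + k * k * fst s1 ''L''"
      show "runs F (Seq offset_prog ?loop) s2 (T * 30 + ?B) ?Q"
      proof (rule runs_Seq[OF offset_prog_runs])
        show "fst s2 ''n'' = n" "fst s2 ''T'' = T" "snd s2 ''W'' 0 = 0"
          by (simp_all add: frame_reg[OF fr2] frame_reg[OF fr1] frame_arr[OF fr2] frame_arr[OF fr1]
              prog_defs input_state_def)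
        fix s3 assume fr3: "frame offset_prog s2 s3" and W: "\<forall>t<T. snd s3 ''W'' t = t * n"
        have reg: "fst s3 x = fst ?s x" if "x \<notin> {''p'', ''L'', ''M'', ''i'', ''j'', ''t''}" for x
          using that by (simp add: frame_reg[OF fr3] frame_reg[OF fr2] frame_reg[OF fr1] prog_defs)
        have "fst s3 ''M'' = 3 + k * k * L"
          using M by (simp add: frame_reg[OF fr3] prog_defs L_def)
        then have "env (3 + k * k * L) s3"
          using W by (simp add: env_def reg) (simp add: input_state_def)
        moreover have "snd s3 ''d'' i = 0" for i
          by (simp add: frame_arr[OF fr3] frame_arr[OF fr2] frame_arr[OF fr1] prog_defs input_state_def)
        moreover have "fst s3 ''c'' = 0" "fst s3 ''answer'' = 0"
          by (simp_all add: reg) (simp_all add: input_state_def)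
        ultimately have "runs F ?loop s3 ((3 + k * k * L) ^ Suc k * (Suc k * (570 * ?X))) ?Q"
          using L by (intro main_loop_runs) (auto simp: L_def)
        then show "runs F ?loop s3 ?B ?Q"
        proof (rule runs_weaken)
          show "(3 + k * k * L) ^ Suc k * (Suc k * (570 * ?X)) \<le> ?B"
            using polylog_power_bound[of L n k] L by (intro mult_le_mono1) (simp only: L_def)
        qed
      qed simp
    qed simp
  qed (simp_all add: input_state_def)
  moreover have "n * 30 + (Suc k * Suc k * 20 + (T * 30 + ?B))
      \<le> 25000 * 3 ^ k * Suc k ^ (3 * Suc k + 2) * T ^ 2 * n ^ 4"
  proof -
    \<comment> \<open>The main loop contributes \<open>36 * 570 = 20520\<close> times
      \<open>Y\<close>, the preparations at most \<open>30 + 20 + 30\<close>. The exponent surplus 2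
      absorbs the factor \<open>Suc k\<close> of the trials and the \<open>Suc k * Suc k\<close> of
      \<open>modulus_prog\<close>.\<close>
    define Y where "Y = 3 ^ k * Suc k ^ (3 * Suc k + 2) * T ^ 2 * n ^ 4"
    have one: "1 \<le> (3::nat) ^ k" "1 \<le> Suc k ^ (3 * Suc k + 2)" "1 \<le> T ^ 2" "1 \<le> n ^ 4"
      using n_pos T_pos by simp_all
    have "1 * 1 * 1 * n ^ 1 \<le> Y" unfolding Y_def
      using one n_pos by (intro mult_le_mono power_increasing) simp_all
    moreover have "1 * 1 * T ^ 1 * 1 \<le> Y" unfolding Y_def
      using one T_pos by (intro mult_le_mono power_increasing) simp_all
    moreover have "1 * Suc k ^ 2 * 1 * 1 \<le> Y" unfolding Y_def
      using one by (intro mult_le_mono power_increasing) simp_all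
    moreover have "?B \<le> 20520 * Y"
    proof -
      have "36 * a * b * n\<^sup>2 * (c * (570 * ?X)) = 20520 * (a * (b * c) * T ^ 2 * n ^ 4)" for a b c :: nat
        by (simp add: power2_eq_square power4_eq_xxxx)
      then have "?B = 20520 * (3 ^ k * (Suc k ^ (3 * Suc k) * Suc k) * T ^ 2 * n ^ 4)" .
      also have "Suc k ^ (3 * Suc k) * Suc k = Suc k ^ (3 * Suc k + 1)"
        by (simp only: power_add power_one_right)
      also have "20520 * (3 ^ k * Suc k ^ (3 * Suc k + 1) * T ^ 2 * n ^ 4) \<le> 20520 * Y"
        unfolding Y_def using n_pos T_pos by (intro mult_le_mono power_increasing) simp_all
      finally show ?thesis .
    qed
    moreover have "25000 * 3 ^ k * Suc k ^ (3 * Suc k + 2) * T ^ 2 * n ^ 4 = 25000 * Y"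
      by (simp only: Y_def mult.assoc)
    ultimately show ?thesis by (simp only: power2_eq_square mult_1 mult_1_right power_one_right)
  qed
  ultimately show ?thesis by (blast intro: runs_weaken)
qed

end

theorem theorem5:
  "\<exists>p :: prog. \<exists>C :: real. \<exists>c :: nat.
     solves_temporal_orienteering p
       (\<lambda>n T k. C * real k ^ (c * k) * real T ^ 4 * real n ^ 4 * max 1 (log 2 (real n)))"
proof (intro exI, unfold solves_temporal_orienteering_def, intro allI impI, elim conjE)
  fix n T vs vt k f :: nat and E :: "(nat \<times> nat) set" and F :: cost_oracle
  assume "temporal_cost_graph {..<n} E T F" "vs < n" "vt < n"
  then interpret orienteering_instance n E T F vs vt k f
    by (simp add: orienteering_instance_def orienteering_instance_axioms_def)
  obtain m s where run: "exec F orienteering_prog (input_state n T vs vt k f) m s"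
    and m: "m \<le> 25000 * 3 ^ k * Suc k ^ (3 * Suc k + 2) * T ^ 2 * n ^ 4"
    and acc: "accepting s \<longleftrightarrow> temporal_orienteering {..<n} T F vs vt k f"
    using orienteering_prog_runs by (rule runsE)
  \<comment> \<open>Instance \<open>a = 2\<close> of \<open>power_Suc_le_power_self\<close>, whence
    the exponent \<open>18 * k\<close> and the constant
    \<open>19200000 = 25000 * 3 * 2 ^ 8\<close>.\<close>
  have "m \<le> 25000 * (3 * 2 ^ (6 + 2) * k ^ ((14 + 2 * 2) * k)) * T ^ 4 * n ^ 4"
  proof (rule order_trans[OF m])
    have "T ^ 2 \<le> T ^ 4" using T_pos by (intro power_increasing) auto
    then have "25000 * (3 ^ k * Suc k ^ (3 * Suc k + 2)) * T ^ 2 * n ^ 4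
        \<le> 25000 * (3 * 2 ^ (6 + 2) * k ^ ((14 + 2 * 2) * k)) * T ^ 4 * n ^ 4"
      by (intro mult_le_mono power_Suc_le_power_self order_refl)
    then show "25000 * 3 ^ k * Suc k ^ (3 * Suc k + 2) * T ^ 2 * n ^ 4
        \<le> 25000 * (3 * 2 ^ (6 + 2) * k ^ ((14 + 2 * 2) * k)) * T ^ 4 * n ^ 4"
      by (simp only: mult.assoc)
  qed
  also have "\<dots> = 19200000 * k ^ (18 * k) * T ^ 4 * n ^ 4" by simp
  finally have "real m \<le> real (19200000 * k ^ (18 * k) * T ^ 4 * n ^ 4)" by (simp only: of_nat_le_iff)
  also have "\<dots> = 19200000 * real k ^ (18 * k) * real T ^ 4 * real n ^ 4 * 1" by simp
  also have "\<dots> \<le> 19200000 * real k ^ (18 * k) * real T ^ 4 * real n ^ 4 * max 1 (log 2 (real n))"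
    by (intro mult_left_mono) auto
  finally show "\<exists>m s. exec F orienteering_prog (input_state n T vs vt k f) m s \<and>
      (accepting s \<longleftrightarrow> temporal_orienteering {..<n} T F vs vt k f) \<and>
      real m \<le> 19200000 * real k ^ (18 * k) * real T ^ 4 * real n ^ 4 * max 1 (log 2 (real n))"
    using run acc by blast
qed

end
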